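(* Suppose that $f$ and $h$ obey Gaussian processes as described in the context. For any $x \in \mathcal{X}$, the posterior mean $\mathbb{E}[f(x) \mid x, \mathcal{D}]$ and the posterior variance $\mathbb{V}[f(x)\mid x,\mathcal{D}]$ of $f(x)$ given $(x,\mathcal{D})$ are $$\mathbb{E}[f(x)\mid x,\mathcal{D}] = k_D(x)^\top\, \mathbb{E}[\widetilde K(h_{1:D})^{-1}\mid \mathcal{D}]\, y^{\mathrm E}_{1:D},$$ $$\mathbb{V}[f(x)\mid x,\mathcal{D}] = k(x,x) + k_D(x)^\top\, \mathcal{K}(\mathcal{D})\, k_D(x),$$ where $$\mathcal{K}(\mathcal{D}) := \mathbb{E}\big[\widetilde K(h_{1:D})^{-1} y^{\mathrm E}_{1:D} (y^{\mathrm E}_{1:D})^\top \widetilde K(h_{1:D})^{-1} \,\big|\, \mathcal{D}\big] - \mathbb{E}[\widetilde K(h_{1:D})^{-1}\mid\mathcal{D}]\, y^{\mathrm E}_{1:D} (y^{\mathrm E}_{1:D})^\top\, \mathbb{E}[\widetilde K(h_{1:D})^{-1}\mid\mathcal{D}] - \mathbb{E}[\widetilde K(h_{1:D})^{-1}\mid\mathcal{D}].$$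
   Context: Data model. Let $\mathcal{X}\subseteq\mathbb{R}^n$, and let $f:\mathcal{X}\to\mathbb{R}$ and $g:\mathcal{X}\to(0,\infty)$ be unknown (random) functions; put $h(x):=\ln g(x)^2$. Let $x_1,\dots,x_D\in\mathcal{X}$ be $D$ given (deterministic) pairwise distinct training inputs. For each $d\in\{1,\dots,D\}$ one observes $S\ge 1$ outputs $y_{d,s}=f(x_d)+w_{d,s}$, $s\in\{1,\dots,S\}$, where $w_{d,s}\mid g(x_d)\sim\mathcal{N}(0,g(x_d)^2)$; the normalized noises $w_{d,s}/g(x_d)$ are i.i.d. $\mathcal{N}(0,1)$ over all $(d,s)$ and independent of $(f,h)$. Gaussian process assumption. $f$ and $h$ are independent zero-mean Gaussian processes with strictly positive definite kernels $k:\mathcal{X}\times\mathcal{X}\to\mathbb{R}$ and $\ell:\mathcal{X}\times\mathcal{X}\to\mathbb{R}$, respectively: for any natural number $N$ and any distinct points $x_1',\dots,x_N'\in\mathcal{X}$, the Gram matrices $(k(x_i',x_j'))_{i,j}$ and $(\ell(x_i',x_j'))_{i,j}$ are positive definite; given any $h$, $[f(x_1'),\dots,f(x_N')]^\top\sim\mathcal{N}(0,(k(x_i',x_j'))_{i,j})$; and given any $f$, $[h(x_1'),\dots,h(x_N')]^\top\sim\mathcal{N}(0,(\ell(x_i',x_j'))_{i,j})$. Notation. $k_D(x):=[k(x,x_1),\dots,k(x,x_D)]^\top\in\mathbb{R}^D$; $K_D:=(k(x_i,x_j))_{i,j=1}^D$; $y^{\mathrm E}_d:=\frac1S\sum_{s=1}^S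 y_{d,s}$; $y^{\mathrm E}_{1:D}:=[y^{\mathrm E}_1,\dots,y^{\mathrm E}_D]^\top$; $h_d:=h(x_d)$; $h_{1:D}:=[h_1,\dots,h_D]^\top$; $\widetilde K(h_{1:D}):=K_D+\frac1S\,\mathrm{diag}(\exp h_1,\dots,\exp h_D)$. The dataset is $\mathcal{D}:=[x_{1:D},y^{\mathrm E}_{1:D}]$; since the inputs are deterministic, conditioning on $\mathcal{D}$ means conditioning on $y^{\mathrm E}_{1:D}$. The expectations of matrix functions of $h_{1:D}$ are taken entrywise with respect to the conditional law of $h_{1:D}$ given $\mathcal{D}$. *)

theory Defs
  imports "HOL-Probability.Probability"
begin

(* The normal law with mean m and variance v; the case v = 0 is the point mass at m. *)
definition normal_law :: "real \<Rightarrow> real \<Rightarrow> real measure" where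
  "normal_law m v =
     (if v = 0 then return borel m
      else density lborel (\<lambda>t. ennreal (normal_density m (sqrt v) t)))"

(* The random vector (Z i), i in I, has law N(m, C), in the sense of the usual definition of
   the multivariate normal law through its one-dimensional projections.  The dimension is
   carried by a finite set I rather than by a type, so that it can be quantified over below. *)
definition multivariate_normal ::
  "'w measure \<Rightarrow> 'i set \<Rightarrow> ('i \<Rightarrow> 'w \<Rightarrow> real) \<Rightarrow> ('i \<Rightarrow> real) \<Rightarrow> ('i \<Rightarrow> 'i \<Rightarrow> real) \<Rightarrow> bool" where
  "multivariate_normal M I Z m C \<longleftrightarrow>
     (\<forall>i\<in>I. Z i \<in> borel_measurable M) \<and>
     (\<forall>a :: 'i \<Rightarrow> real.
        distr M borel (\<lambda>\<omega>. \<Sum>i\<in>I. a i * Z i \<omega>) =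
        normal_law (\<Sum>i\<in>I. a i * m i) (\<Sum>i\<in>I. \<Sum>j\<in>I. a i * C i j * a j))"

definition positive_definite_on :: "'i set \<Rightarrow> ('i \<Rightarrow> 'i \<Rightarrow> real) \<Rightarrow> bool" where
  "positive_definite_on I A \<longleftrightarrow>
     (\<forall>i\<in>I. \<forall>j\<in>I. A i j = A j i) \<and>
     (\<forall>c :: 'i \<Rightarrow> real. (\<exists>i\<in>I. c i \<noteq> 0) \<longrightarrow> (\<Sum>i\<in>I. \<Sum>j\<in>I. c i * A i j * c j) > 0)"

definition strictly_pd_kernel :: "'a set \<Rightarrow> ('a \<Rightarrow> 'a \<Rightarrow> real) \<Rightarrow> bool" where
  "strictly_pd_kernel X k \<longleftrightarrow>
     (\<forall>(N::nat) p. inj_on p {1..N} \<and> p ` {1..N} \<subseteq> X \<longrightarrow>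
        positive_definite_on {1..N} (\<lambda>i j. k (p i) (p j)))"

definition zero_mean_gp ::
  "'w measure \<Rightarrow> 'a set \<Rightarrow> ('a \<Rightarrow> 'a \<Rightarrow> real) \<Rightarrow> ('a \<Rightarrow> 'w \<Rightarrow> real) \<Rightarrow> bool" where
  "zero_mean_gp M X k f \<longleftrightarrow>
     (\<forall>(N::nat) p. inj_on p {1..N} \<and> p ` {1..N} \<subseteq> X \<longrightarrow>
        multivariate_normal M {1..N} (\<lambda>i. f (p i)) (\<lambda>_. 0) (\<lambda>i j. k (p i) (p j)))"

definition generated_events :: "'w measure \<Rightarrow> 'i set \<Rightarrow> ('i \<Rightarrow> 'w \<Rightarrow> real) \<Rightarrow> 'w set set" where
  "generated_events M I Z =
     sigma_sets (space M) {Z i -` B \<inter> space M | i B. i \<in> I \<and> B \<in> sets borel}"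

definition kernel_vec :: "('a \<Rightarrow> 'a \<Rightarrow> real) \<Rightarrow> ('d::finite \<Rightarrow> 'a) \<Rightarrow> 'a \<Rightarrow> real ^ 'd" where
  "kernel_vec k xs x = (\<chi> i. k x (xs i))"

definition gram :: "('a \<Rightarrow> 'a \<Rightarrow> real) \<Rightarrow> ('d::finite \<Rightarrow> 'a) \<Rightarrow> real ^ 'd ^ 'd" where
  "gram k xs = (\<chi> i j. k (xs i) (xs j))"

definition noisy_gram ::
  "('a \<Rightarrow> 'a \<Rightarrow> real) \<Rightarrow> ('d::finite \<Rightarrow> 'a) \<Rightarrow> nat \<Rightarrow> real ^ 'd \<Rightarrow> real ^ 'd ^ 'd" where
  "noisy_gram k xs S \<eta> =
     gram k xs + (1 / real S) *\<^sub>R (\<chi> i j. if i = j then exp (\<eta> $ i) else 0)"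

definition outer :: "real ^ 'd \<Rightarrow> real ^ 'd \<Rightarrow> real ^ 'd ^ 'd" where
  "outer u v = (\<chi> i j. u $ i * v $ j)"

definition empirical_mean ::
  "nat \<Rightarrow> ('d::finite \<Rightarrow> nat \<Rightarrow> 'w \<Rightarrow> real) \<Rightarrow> 'w \<Rightarrow> real ^ 'd" where
  "empirical_mean S y \<omega> = (\<chi> d. (1 / real S) * (\<Sum>s=1..S. y d s \<omega>))"

definition cond_exp_matrix ::
  "'w measure \<Rightarrow> 'w measure \<Rightarrow> ('w \<Rightarrow> real ^ 'm::finite ^ 'n::finite) \<Rightarrow> 'w \<Rightarrow> real ^ 'm ^ 'n" where
  "cond_exp_matrix M F A \<omega> = (\<chi> i j. real_cond_exp M F (\<lambda>\<omega>'. A \<omega>' $ i $ j) \<omega>)"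

definition cond_variance :: "'w measure \<Rightarrow> 'w measure \<Rightarrow> ('w \<Rightarrow> real) \<Rightarrow> 'w \<Rightarrow> real" where
  "cond_variance M F Z =
     real_cond_exp M F (\<lambda>\<omega>. (Z \<omega> - real_cond_exp M F Z \<omega>)\<^sup>2)"

end

theory Submission imports Defs begin

text \<open>
Conditioning on the log noise levels \<open>h\<close> turns the model into ordinary Gaussian regression. With
the levels frozen at \<open>e\<close>, the value \<open>f(x)\<close> and the averaged data \<open>Y\<close> are jointly Gaussian, with
covariance \<open>k\<^sub>x\<close> between them and covariance matrix \<open>K(e)\<close> of \<open>Y\<close>. The residual
\<open>R = f(x) - k\<^sub>x\<^sup>T K(h)\<^sup>-\<^sup>1 Y\<close> is therefore uncorrelated with \<open>Y\<close> given \<open>h\<close>, hence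
independent of it given \<open>h\<close>, with conditional mean \<open>0\<close> and conditional variance
\<open>v(h) = k(x,x) - k\<^sub>x\<^sup>T K(h)\<^sup>-\<^sup>1 k\<^sub>x\<close>. Writing \<open>m\<close> for the fitted value
\<open>k\<^sub>x\<^sup>T K(h)\<^sup>-\<^sup>1 Y\<close> and integrating \<open>h\<close> out against its law given the data,
\<open>E[f(x) | Y] = E[m | Y]\<close> and \<open>E[f(x)\<^sup>2 | Y] = E[m\<^sup>2 | Y] + E[v(h) | Y]\<close>; pulling the
\<open>Y\<close>-measurable factors out of the conditional expectations gives the two formulas.

The argument is carried out without constructing conditional laws. What is used about \<open>R\<close> is that
\<open>E[R \<phi>(Y,h)] = 0\<close> and \<open>E[(R\<^sup>2 - v(h)) \<phi>(Y,h)] = 0\<close> for all admissible \<open>\<phi>\<close>. By uniqueness of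
Fourier transforms, in the weighted form \<open>zero_fourier_transform_real\<close>, it suffices to take \<open>\<phi>\<close>
to be a character. As \<open>h\<close> is independent of \<open>f\<close> and of the normalised noise jointly, Fubini's
theorem (\<open>integral_indep_iterated\<close>) lets \<open>h\<close> be frozen, and \<open>uncorrelated_gaussian_factor\<close>, a statement
about two real Gaussian variables, finishes the computation (\<open>fixed_level_uncorrelated\<close>).

Integrability rests on two bounds: \<open>K(h)\<close> dominates the Gram matrix \<open>K\<close>, so its inverse is
bounded uniformly in \<open>h\<close>; and \<open>exp h\<close> has finite mean because \<open>h\<close> is Gaussian, so that
\<open>Y\<close> is square integrable.
\<close>

section \<open>Weights with vanishing Fourier transform\<close>

lemma (in prob_space) integrable_mult_iexp:
  fixes W :: "'a \<Rightarrow> complex"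
  assumes "integrable M W" and [measurable]: "Y \<in> borel_measurable M"
  shows "integrable M (\<lambda>\<omega>. W \<omega> * iexp (Y \<omega>))"
  by (rule Bochner_Integration.integrable_bound[OF assms(1)])
     (use assms(1) in \<open>auto simp: norm_mult\<close>)

text \<open>
Levy's uniqueness theorem for signed measures. The value of the transform at \<open>0\<close> says that the
positive and the negative part of the weight have the same mass, so both can be normalised to laws
of \<open>Y\<close> under a changed measure, and these laws have equal characteristic functions.
\<close>

lemma (in prob_space) zero_fourier_transform_line_real:
  fixes W Y :: "'a \<Rightarrow> real"
  assumes W: "integrable M W" and Y[measurable]: "Y \<in> borel_measurable M"
    and zero: "\<And>t. (\<integral>\<omega>. complex_of_real (W \<omega>) * iexp (t * Y \<omega>) \<partial>M) = 0"
    and B[measurable]: "B \<in> sets borel"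
  shows "(\<integral>\<omega>. W \<omega> * indicator B (Y \<omega>) \<partial>M) = 0"
proof -
  have [measurable]: "W \<in> borel_measurable M" using W by auto
  define P where "P = (\<lambda>\<omega>. max 0 (W \<omega>))"
  define N where "N = (\<lambda>\<omega>. max 0 (- W \<omega>))"
  have W_eq: "W = (\<lambda>\<omega>. P \<omega> - N \<omega>)" by (auto simp: P_def N_def fun_eq_iff)
  have P: "integrable M P" "\<And>\<omega>. 0 \<le> P \<omega>" and N: "integrable M N" "\<And>\<omega>. 0 \<le> N \<omega>"
    using W by (auto simp: P_def N_def)
  have [measurable]: "P \<in> borel_measurable M" "N \<in> borel_measurable M"
    using P(1) N(1) by auto
  define c where "c = (\<integral>\<omega>. P \<omega> \<partial>M)"
  have "(\<integral>\<omega>. complex_of_real (W \<omega>) \<partial>M) = 0" using zero[of 0] by simp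
  then have "(\<integral>\<omega>. W \<omega> \<partial>M) = 0" by simp
  then have cN: "c = (\<integral>\<omega>. N \<omega> \<partial>M)"
    unfolding W_eq c_def using P(1) N(1) by simp
  show ?thesis
  proof (cases "c = 0")
    case True
    have "AE \<omega> in M. P \<omega> = 0" "AE \<omega> in M. N \<omega> = 0"
      using True cN P N integral_nonneg_eq_0_iff_AE[of M P] integral_nonneg_eq_0_iff_AE[of M N]
      by (auto simp: c_def)
    then have "AE \<omega> in M. W \<omega> * indicator B (Y \<omega>) = 0"
      by eventually_elim (auto simp: W_eq)
    then show ?thesis by (rule integral_eq_zero_AE)
  next
    case False
    have "c \<ge> 0" unfolding c_def using P by simp
    with False have c: "c > 0" by simp
    \<comment> \<open>Normalising both parts of the weight gives laws on the line to compare.\<close>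
    define law where "law = (\<lambda>Q :: 'a \<Rightarrow> real.
      distr (density M (\<lambda>\<omega>. ennreal (Q \<omega> / c))) borel Y)"
    have law: "real_distribution (law Q)"
      "char (law Q) t = (\<integral>\<omega>. complex_of_real (Q \<omega>) * iexp (t * Y \<omega>) \<partial>M) / c"
      "measure (law Q) B = (\<integral>\<omega>. Q \<omega> * indicator B (Y \<omega>) \<partial>M) / c"
      if Q: "integrable M Q" "\<And>\<omega>. 0 \<le> Q \<omega>" "(\<integral>\<omega>. Q \<omega> \<partial>M) = c" for Q t
    proof -
      have [measurable]: "Q \<in> borel_measurable M" using Q(1) by auto
      interpret D: prob_space "density M (\<lambda>\<omega>. ennreal (Q \<omega> / c))"
        using Q c by (intro prob_spaceI)
          (simp add: emeasure_density nn_integral_eq_integral)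
      interpret L: prob_space "law Q" unfolding law_def by (rule D.prob_space_distr) simp
      show "real_distribution (law Q)"
        using L.prob_space_axioms
        by (auto simp: real_distribution_def real_distribution_axioms_def law_def)
      have "char (law Q) t = (\<integral>\<omega>. complex_of_real (Q \<omega> / c) * iexp (t * Y \<omega>) \<partial>M)"
        unfolding char_def law_def using c Q(2)
        by (subst integral_distr) (simp_all add: integral_density scaleR_conv_of_real)
      also have "\<dots> = (\<integral>\<omega>. complex_of_real (Q \<omega>) * iexp (t * Y \<omega>) \<partial>M) / c"
        by (simp)
      finally show "char (law Q) t = (\<integral>\<omega>. complex_of_real (Q \<omega>) * iexp (t * Y \<omega>) \<partial>M) / c" .
      have "measure (law Q) B = (\<integral>y. indicator B y \<partial>law Q)"
        by (simp add: law_def)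
      also have "\<dots> = (\<integral>\<omega>. Q \<omega> / c * indicator B (Y \<omega>) \<partial>M)"
        unfolding law_def using c Q(2)
        by (subst integral_distr) (simp_all add: integral_density)
      finally show "measure (law Q) B = (\<integral>\<omega>. Q \<omega> * indicator B (Y \<omega>) \<partial>M) / c"
        by simp
    qed
    have "char (law P) t = char (law N) t" for t
    proof -
      have "integrable M (\<lambda>\<omega>. complex_of_real (P \<omega>) * iexp (t * Y \<omega>))"
           "integrable M (\<lambda>\<omega>. complex_of_real (N \<omega>) * iexp (t * Y \<omega>))"
        using P(1) N(1) by (auto intro!: integrable_mult_iexp simp del: of_real_mult)
      then show ?thesis
        using zero[of t] law(2)[OF P] law(2)[OF N] cN
        by (simp add: W_eq c_def left_diff_distrib)
    qed
    then have "law P = law N"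
      using law(1)[OF P] law(1)[OF N] cN by (intro Levy_uniqueness) (auto simp: c_def)
    then have "(\<integral>\<omega>. P \<omega> * indicator B (Y \<omega>) \<partial>M) = (\<integral>\<omega>. N \<omega> * indicator B (Y \<omega>) \<partial>M)"
      using law(3)[OF P] law(3)[OF N] cN c by (simp add: c_def)
    moreover have "integrable M (\<lambda>\<omega>. P \<omega> * indicator B (Y \<omega>))"
      "integrable M (\<lambda>\<omega>. N \<omega> * indicator B (Y \<omega>))"
      using integrable_real_mult_indicator[of "Y -` B \<inter> space M" M P]
            integrable_real_mult_indicator[of "Y -` B \<inter> space M" M N] P(1) N(1)
      by (auto simp: indicator_def cong: Bochner_Integration.integrable_cong if_cong)
    ultimately show ?thesis by (simp add: W_eq left_diff_distrib)
  qed
qed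

lemma (in prob_space) zero_fourier_transform_cnj:
  fixes W :: "'a \<Rightarrow> complex" and Y :: "'a \<Rightarrow> 'b::real_inner"
  assumes zero: "\<And>t. (\<integral>\<omega>. W \<omega> * iexp (t \<bullet> Y \<omega>) \<partial>M) = 0"
  shows "(\<integral>\<omega>. cnj (W \<omega>) * iexp (t \<bullet> Y \<omega>) \<partial>M) = 0"
proof -
  have "(\<integral>\<omega>. cnj (W \<omega>) * iexp (t \<bullet> Y \<omega>) \<partial>M)
      = (\<integral>\<omega>. cnj (W \<omega> * iexp ((- t) \<bullet> Y \<omega>)) \<partial>M)"
    by (simp add: exp_cnj)
  also have "\<dots> = cnj (\<integral>\<omega>. W \<omega> * iexp ((- t) \<bullet> Y \<omega>) \<partial>M)"
    by (simp del: complex_cnj_mult)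
  also have "\<dots> = 0" by (simp only: zero complex_cnj_zero)
  finally show ?thesis .
qed

text \<open>
The hypothesis holds for all frequencies, in particular for \<open>-t\<close>; conjugating the weight therefore
preserves it, and so does taking real and imaginary parts. This reduces complex weights to real ones.
\<close>

lemma (in prob_space) zero_fourier_transform_Re_Im:
  fixes W :: "'a \<Rightarrow> complex" and Y :: "'a \<Rightarrow> 'b::{real_inner,second_countable_topology}"
  assumes W: "integrable M W" and Y[measurable]: "Y \<in> borel_measurable M"
    and zero: "\<And>t. (\<integral>\<omega>. W \<omega> * iexp (t \<bullet> Y \<omega>) \<partial>M) = 0"
  shows "(\<integral>\<omega>. complex_of_real (Re (W \<omega>)) * iexp (t \<bullet> Y \<omega>) \<partial>M) = 0"
    and "(\<integral>\<omega>. complex_of_real (Im (W \<omega>)) * iexp (t \<bullet> Y \<omega>) \<partial>M) = 0"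
proof -
  have i: "integrable M (\<lambda>\<omega>. W \<omega> * iexp (t \<bullet> Y \<omega>))"
       "integrable M (\<lambda>\<omega>. cnj (W \<omega>) * iexp (t \<bullet> Y \<omega>))"
    using W by (auto intro!: integrable_mult_iexp)
  have "(\<lambda>\<omega>. complex_of_real (Re (W \<omega>)) * iexp (t \<bullet> Y \<omega>))
      = (\<lambda>\<omega>. (W \<omega> * iexp (t \<bullet> Y \<omega>) + cnj (W \<omega>) * iexp (t \<bullet> Y \<omega>)) / 2)"
    by (simp add: fun_eq_iff complex_add_cnj flip: distrib_right)
  then show "(\<integral>\<omega>. complex_of_real (Re (W \<omega>)) * iexp (t \<bullet> Y \<omega>) \<partial>M) = 0"
    using i zero zero_fourier_transform_cnj[of W Y, OF zero] by simp
  have "(\<lambda>\<omega>. complex_of_real (Im (W \<omega>)) * iexp (t \<bullet> Y \<omega>))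
      = (\<lambda>\<omega>. (W \<omega> * iexp (t \<bullet> Y \<omega>) - cnj (W \<omega>) * iexp (t \<bullet> Y \<omega>)) / (2 * \<i>))"
    by (simp add: fun_eq_iff complex_diff_cnj field_simps flip: left_diff_distrib)
  then show "(\<integral>\<omega>. complex_of_real (Im (W \<omega>)) * iexp (t \<bullet> Y \<omega>) \<partial>M) = 0"
    using i zero zero_fourier_transform_cnj[of W Y, OF zero] by simp
qed

lemma (in prob_space) integrable_mult_indicator_preimage:
  fixes W :: "'a \<Rightarrow> complex"
  assumes W: "integrable M W" and [measurable]: "Y \<in> measurable M N" "B \<in> sets N"
  shows "integrable M (\<lambda>\<omega>. W \<omega> * indicator B (Y \<omega>))"
  by (rule Bochner_Integration.integrable_bound[OF W])
     (use W in \<open>auto simp: norm_mult indicator_def\<close>)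

text \<open>
Complex weights are allowed because the passage to several dimensions puts characters in the other
coordinates into the weight.
\<close>

lemma (in prob_space) zero_fourier_transform_line:
  fixes W :: "'a \<Rightarrow> complex" and Y :: "'a \<Rightarrow> real"
  assumes W: "integrable M W" and Y[measurable]: "Y \<in> borel_measurable M"
    and zero: "\<And>t. (\<integral>\<omega>. W \<omega> * iexp (t * Y \<omega>) \<partial>M) = 0"
    and B[measurable]: "B \<in> sets borel"
  shows "(\<integral>\<omega>. W \<omega> * indicator B (Y \<omega>) \<partial>M) = 0"
proof (rule complex_eqI)
  note RI = zero_fourier_transform_Re_Im[OF W Y, unfolded inner_real_def, OF zero]
  have int: "integrable M (\<lambda>\<omega>. W \<omega> * indicator B (Y \<omega>))"
    by (rule integrable_mult_indicator_preimage[OF W Y B])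
  have ind: "(indicator B y :: complex) = complex_of_real (indicator B y)" for y
    by (simp add: indicator_def)
  have "(\<integral>\<omega>. Re (W \<omega>) * indicator B (Y \<omega>) \<partial>M) = 0"
    using W RI(1) by (intro zero_fourier_transform_line_real) auto
  then show "Re (\<integral>\<omega>. W \<omega> * indicator B (Y \<omega>) \<partial>M) = Re 0"
    using int by (simp add: integral_Re[symmetric] ind del: of_real_indicator)
  have "(\<integral>\<omega>. Im (W \<omega>) * indicator B (Y \<omega>) \<partial>M) = 0"
    using W RI(2) by (intro zero_fourier_transform_line_real) auto
  then show "Im (\<integral>\<omega>. W \<omega> * indicator B (Y \<omega>) \<partial>M) = Im 0"
    using int by (simp add: integral_Im[symmetric] ind del: of_real_indicator)
qed

text \<open>
One coordinate at a time: the characters in the remaining coordinates are absorbed into the weight,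
the uniqueness theorem on the line replaces the character in the chosen coordinate by an indicator,
and this indicator joins the weight for the induction.
\<close>

lemma (in prob_space) zero_fourier_transform_rectangle:
  fixes W :: "'a \<Rightarrow> complex" and Y :: "'i \<Rightarrow> 'a \<Rightarrow> real"
  assumes "finite I" and "integrable M W"
    and "\<And>i. i \<in> I \<Longrightarrow> Y i \<in> borel_measurable M" "\<And>i. i \<in> I \<Longrightarrow> B i \<in> sets borel"
    and "\<And>t. (\<integral>\<omega>. W \<omega> * iexp (\<Sum>i\<in>I. t i * Y i \<omega>) \<partial>M) = 0"
  shows "(\<integral>\<omega>. W \<omega> * (\<Prod>i\<in>I. indicator (B i) (Y i \<omega>)) \<partial>M) = 0"
  using assms
proof (induction I arbitrary: W rule: finite_induct)
  case empty
  then show ?case by simp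
next
  case (insert a I)
  have [measurable]: "Y a \<in> borel_measurable M" "B a \<in> sets borel"
    "\<And>i. i \<in> I \<Longrightarrow> Y i \<in> borel_measurable M" using insert.prems by auto
  have "(\<integral>\<omega>. (W \<omega> * indicator (B a) (Y a \<omega>)) * iexp (\<Sum>i\<in>I. t i * Y i \<omega>) \<partial>M) = 0" for t
  proof -
    \<comment> \<open>The other frequencies stay fixed while the one of \<open>Y a\<close> varies.\<close>
    have "(\<integral>\<omega>. (W \<omega> * iexp (\<Sum>i\<in>I. t i * Y i \<omega>)) * iexp (s * Y a \<omega>) \<partial>M) = 0" for s
    proof -
      have "(\<Sum>i\<in>insert a I. (t(a := s)) i * Y i \<omega>) = (\<Sum>i\<in>I. t i * Y i \<omega>) + s * Y a \<omega>" for \<omega>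
        using insert.hyps by (auto intro!: sum.cong)
      then show ?thesis
        using insert.prems(4)[of "t(a := s)"] by (simp add: exp_add ring_distribs mult.assoc)
    qed
    then have "(\<integral>\<omega>. (W \<omega> * iexp (\<Sum>i\<in>I. t i * Y i \<omega>)) * indicator (B a) (Y a \<omega>) \<partial>M) = 0"
      by (intro zero_fourier_transform_line integrable_mult_iexp insert.prems) auto
    then show ?thesis by (simp add: mult_ac)
  qed
  then have "(\<integral>\<omega>. (W \<omega> * indicator (B a) (Y a \<omega>)) * (\<Prod>i\<in>I. indicator (B i) (Y i \<omega>)) \<partial>M) = 0"
    using insert.prems by (intro insert.IH integrable_mult_indicator_preimage[where N = borel]) auto
  then show ?case using insert.hyps by (simp add: mult_ac)
qed

text \<open>
The sets with vanishing weighted mass form a Dynkin system, since the total mass, which is the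
transform at \<open>0\<close>, vanishes. It contains the boxes, which are stable under intersection and generate the Borel sets.
\<close>

lemma (in prob_space) zero_fourier_transform_indicator:
  fixes W :: "'a \<Rightarrow> complex" and Y :: "'a \<Rightarrow> 'b::euclidean_space"
  assumes W: "integrable M W" and Y[measurable]: "Y \<in> borel_measurable M"
    and zero: "\<And>t. (\<integral>\<omega>. W \<omega> * iexp (t \<bullet> Y \<omega>) \<partial>M) = 0"
    and B: "B \<in> sets borel"
  shows "(\<integral>\<omega>. W \<omega> * indicator B (Y \<omega>) \<partial>M) = 0"
proof -
  have [measurable]: "W \<in> borel_measurable M" using W by auto
  have Int: "Int_stable (range (\<lambda>(a, b). box a b :: 'b set))"
    by (auto simp: Int_stable_def box_Int_box)
  have closed: "range (\<lambda>(a, b). box a b :: 'b set) \<subseteq> Pow UNIV" by simp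
  have borel: "sets (borel :: 'b measure) = sigma_sets UNIV (range (\<lambda>(a, b). box a b))"
    by (simp add: borel_eq_box)
  from B have "B \<in> sigma_sets UNIV (range (\<lambda>(a, b). box a b :: 'b set))" by (simp only: borel)
  then show ?thesis
  proof (induction rule: sigma_sets_induct_disjoint[OF Int closed, consumes 1, case_names basic empty compl union])
    case (basic A)
    then obtain a b where A: "A = box a b" by auto
    have box: "(indicator A y :: complex)
        = (\<Prod>i\<in>Basis. indicator {a \<bullet> i <..< b \<bullet> i} (i \<bullet> y))" for y
    proof (cases "y \<in> A")
      case True
      then show ?thesis by (auto simp: A mem_box inner_commute)
    next
      case False
      then obtain i where i: "i \<in> Basis" "i \<bullet> y \<notin> {a \<bullet> i <..< b \<bullet> i}"
        by (auto simp: A mem_box inner_commute)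
      then have "(\<Prod>i\<in>Basis. indicator {a \<bullet> i <..< b \<bullet> i} (i \<bullet> y)) = (0::complex)"
        by (intro prod_zero) (auto intro!: bexI[of _ i])
      with False show ?thesis by simp
    qed
    have "(\<integral>\<omega>. W \<omega> * (\<Prod>i\<in>Basis. indicator {a \<bullet> i <..< b \<bullet> i} (i \<bullet> Y \<omega>)) \<partial>M) = 0"
    proof (rule zero_fourier_transform_rectangle)
      fix t :: "'b \<Rightarrow> real"
      show "(\<integral>\<omega>. W \<omega> * iexp (\<Sum>i\<in>Basis. t i * (i \<bullet> Y \<omega>)) \<partial>M) = 0"
        using zero[of "\<Sum>i\<in>Basis. t i *\<^sub>R i"] by (simp add: inner_sum_left)
    qed (use W in auto)
    then show ?case by (simp add: box)
  next
    case empty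
    show ?case by simp
  next
    case (compl A)
    have [measurable]: "A \<in> sets borel" using compl by (simp only: borel)
    have "(\<integral>\<omega>. W \<omega> \<partial>M) = 0" using zero[of 0] by simp
    moreover have "W \<omega> * indicator (UNIV - A) (Y \<omega>) = W \<omega> - W \<omega> * indicator A (Y \<omega>)" for \<omega>
      by (simp add: indicator_def)
    ultimately show ?case
      using compl.IH W integrable_mult_indicator_preimage[OF W Y, of A] by simp
  next
    case (union A)
    have [measurable]: "A i \<in> sets borel" for i using union by (auto simp only: borel)
    have ind: "indicator (\<Union>i. A i) y = (\<Sum>i. indicator (A i) y :: complex)"
      and sm: "summable (\<lambda>i. norm (indicator (A i) y :: complex))" for y
    proof -
      have fin: "finite {i. y \<in> A i}"
      proof (cases "\<exists>i. y \<in> A i")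
        case True
        then obtain j where "y \<in> A j" by auto
        then have "{i. y \<in> A i} \<subseteq> {j}" using union(1) by (auto simp: disjoint_family_on_def)
        then show ?thesis using finite_subset by blast
      qed auto
      show "summable (\<lambda>i. norm (indicator (A i) y :: complex))"
        by (rule summable_finite[OF fin]) auto
      show "indicator (\<Union>i. A i) y = (\<Sum>i. indicator (A i) y :: complex)"
      proof (cases "\<exists>i. y \<in> A i")
        case True
        then obtain j where j: "y \<in> A j" by auto
        have "indicator (A i) y = (if i = j then 1 else 0 :: complex)" for i
          using union(1) j by (auto simp: disjoint_family_on_def indicator_def)
        then have "(\<lambda>i. indicator (A i) y :: complex) = (\<lambda>i. if i = j then 1 else 0)" by auto
        moreover have "indicator (\<Union>i. A i) y = (1 :: complex)"
          using j by (auto intro!: indicator_simps)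
        ultimately show ?thesis using sums_single[of j "\<lambda>_. 1 :: complex"]
          by (simp add: sums_iff)
      qed auto
    qed
    have "(\<integral>\<omega>. W \<omega> * indicator (\<Union>i. A i) (Y \<omega>) \<partial>M)
        = (\<integral>\<omega>\<in>(\<Union>i. Y -` A i \<inter> space M). W \<omega> \<partial>M)"
      unfolding set_lebesgue_integral_def
      by (intro Bochner_Integration.integral_cong) (auto simp: indicator_def)
    also have "\<dots> = (\<Sum>i. \<integral>\<omega>\<in>(Y -` A i \<inter> space M). W \<omega> \<partial>M)"
    proof (rule lebesgue_integral_countable_add)
      show "set_integrable M (\<Union>i. Y -` A i \<inter> space M) W"
        unfolding set_integrable_def using W by (intro integrable_mult_indicator) auto
    qed (use union(1) in \<open>auto simp: disjoint_family_on_def\<close>)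
    also have "\<dots> = (\<Sum>i. \<integral>\<omega>. W \<omega> * indicator (A i) (Y \<omega>) \<partial>M)"
      unfolding set_lebesgue_integral_def
      by (intro suminf_cong Bochner_Integration.integral_cong) (auto simp: indicator_def)
    also have "\<dots> = 0" using union by simp
    finally show ?case .
  qed
qed

lemma (in prob_space) subalgebra_vimage_algebra:
  assumes "Y \<in> measurable M N"
  shows "subalgebra M (vimage_algebra (space M) Y N)"
  using assms by (auto simp: subalgebra_def sets_vimage_algebra2 measurable_def)

lemma (in prob_space) sigma_finite_vimage_algebra:
  assumes "Y \<in> measurable M N"
  shows "sigma_finite_subalgebra M (vimage_algebra (space M) Y N)"
  by (intro finite_measure_subalgebra_is_sigma_finite finite_measure_subalgebra.intro
      finite_measure_axioms finite_measure_subalgebra_axioms.intro subalgebra_vimage_algebra assms)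

text \<open>
Every event of the generated algebra is a preimage under \<open>Y\<close>, so the hypothesis is the defining
property of a vanishing conditional expectation.
\<close>

lemma (in prob_space) real_cond_exp_vimage_eq_0:
  fixes W :: "'a \<Rightarrow> real"
  assumes W: "integrable M W" and Y: "Y \<in> measurable M N"
    and zero: "\<And>B. B \<in> sets N \<Longrightarrow> (\<integral>\<omega>. W \<omega> * indicator B (Y \<omega>) \<partial>M) = 0"
  shows "AE \<omega> in M. real_cond_exp M (vimage_algebra (space M) Y N) W \<omega> = 0"
proof -
  interpret F: sigma_finite_subalgebra M "vimage_algebra (space M) Y N"
    by (rule sigma_finite_vimage_algebra[OF Y])
  show ?thesis
  proof (rule F.real_cond_exp_charact)
    fix A assume "A \<in> sets (vimage_algebra (space M) Y N)"
    then obtain B where B: "B \<in> sets N" "A = Y -` B \<inter> space M"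
      using Y by (auto simp: sets_vimage_algebra2 measurable_def)
    have "(\<integral>\<omega>\<in>A. W \<omega> \<partial>M) = (\<integral>\<omega>. W \<omega> * indicator B (Y \<omega>) \<partial>M)"
      unfolding set_lebesgue_integral_def
      by (intro Bochner_Integration.integral_cong) (auto simp: B indicator_def)
    then show "(\<integral>\<omega>\<in>A. W \<omega> \<partial>M) = (\<integral>\<omega>\<in>A. 0 \<partial>M)"
      using zero[OF B(1)] by simp
  qed (use W in auto)
qed

text \<open>
Indicators extend to every \<open>\<phi>\<close> for which the integral makes sense: the conditional expectation of \<open>W\<close>
given \<open>Y\<close> vanishes, and the factor \<open>\<phi>(Y)\<close> may be moved in and out of it.
\<close>

lemma (in prob_space) zero_fourier_transform_real:
  fixes W :: "'a \<Rightarrow> real" and Y :: "'a \<Rightarrow> 'b::euclidean_space"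
  assumes W: "integrable M W" and Y[measurable]: "Y \<in> borel_measurable M"
    and zero: "\<And>t. (\<integral>\<omega>. complex_of_real (W \<omega>) * iexp (t \<bullet> Y \<omega>) \<partial>M) = 0"
    and \<phi>[measurable]: "\<phi> \<in> borel_measurable borel"
    and int: "integrable M (\<lambda>\<omega>. \<phi> (Y \<omega>) * W \<omega>)"
  shows "(\<integral>\<omega>. \<phi> (Y \<omega>) * W \<omega> \<partial>M) = 0"
proof -
  let ?F = "vimage_algebra (space M) Y borel"
  interpret F: sigma_finite_subalgebra M ?F
    by (rule sigma_finite_vimage_algebra[OF Y])
  have "(\<integral>\<omega>. W \<omega> * indicator B (Y \<omega>) \<partial>M) = 0" if "B \<in> sets borel" for B
  proof -
    have "(\<integral>\<omega>. complex_of_real (W \<omega>) * indicator B (Y \<omega>) \<partial>M) = 0"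
      using W that by (intro zero_fourier_transform_indicator zero) auto
    also have "(\<lambda>\<omega>. complex_of_real (W \<omega>) * indicator B (Y \<omega>))
        = (\<lambda>\<omega>. complex_of_real (W \<omega> * indicator B (Y \<omega>)))"
      by (auto simp: indicator_def)
    finally show ?thesis unfolding integral_complex_of_real by simp
  qed
  then have ae: "AE \<omega> in M. real_cond_exp M ?F W \<omega> = 0"
    by (intro real_cond_exp_vimage_eq_0 W Y)
  have [measurable]: "Y \<in> measurable ?F borel" 
    by (rule measurable_vimage_algebra1) auto
  have "(\<integral>\<omega>. \<phi> (Y \<omega>) * W \<omega> \<partial>M) = (\<integral>\<omega>. \<phi> (Y \<omega>) * real_cond_exp M ?F W \<omega> \<partial>M)"
    using int W by (intro F.real_cond_exp_intg(2)[symmetric]) auto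
  also have "\<dots> = 0"
    using ae by (intro integral_eq_zero_AE) (auto elim!: eventually_mono)
  finally show ?thesis .
qed

section \<open>Centred normal laws\<close>

lemma char_normal_law_0:
  assumes "v \<ge> 0"
  shows "char (normal_law 0 v) t = exp (- (t\<^sup>2 * v) / 2)"
proof (cases "v = 0")
  case True
  then show ?thesis by (simp add: normal_law_def char_def integral_return)
next
  case False
  interpret S: prob_space std_normal_distribution by (rule prob_space_normal_density) simp
  have "distributed std_normal_distribution lborel (\<lambda>x. x) std_normal_density"
    by (auto simp: distributed_def distr_id2)
  then have "distributed std_normal_distribution lborel (\<lambda>x. 0 + sqrt v * x)
      (normal_density (0 + sqrt v * 0) (\<bar>sqrt v\<bar> * 1))"
    using assms False by (intro S.normal_density_affine) auto
  then have eq: "normal_law 0 v = distr std_normal_distribution borel (\<lambda>x. sqrt v * x)"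
    using assms False by (simp add: normal_law_def distributed_def cong: distr_cong)
  have "char (normal_law 0 v) t = char std_normal_distribution (t * sqrt v)"
    unfolding eq char_def by (subst integral_distr) (auto simp: mult.assoc)
  then show ?thesis
    using assms by (simp add: char_std_normal_distribution power_mult_distrib exp_of_real)
qed

lemma prob_space_normal_law: "v \<ge> 0 \<Longrightarrow> prob_space (normal_law m v)"
  by (auto simp: normal_law_def intro!: prob_space_return prob_space_normal_density)

lemma sets_normal_law[simp, measurable_cong]: "sets (normal_law m v) = sets borel"
  by (simp add: normal_law_def)

lemma space_normal_law[simp]: "space (normal_law m v) = UNIV"
  by (simp add: normal_law_def)

lemma normal_law_0_moments:
  assumes "v \<ge> 0"
  shows "integrable (normal_law 0 v) (\<lambda>x. x)" "(\<integral>x. x \<partial>normal_law 0 v) = 0"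
    "integrable (normal_law 0 v) (\<lambda>x. x\<^sup>2)" "(\<integral>x. x\<^sup>2 \<partial>normal_law 0 v) = v"
proof -
  have "integrable (normal_law 0 v) (\<lambda>x. x) \<and> (\<integral>x. x \<partial>normal_law 0 v) = 0 \<and>
    integrable (normal_law 0 v) (\<lambda>x. x\<^sup>2) \<and> (\<integral>x. x\<^sup>2 \<partial>normal_law 0 v) = v"
  proof (cases "v = 0")
    case True
    then show ?thesis
      by (simp add: normal_law_def integral_return integrable_iff_bounded nn_integral_return)
  next
    case False
    then have v: "sqrt v > 0" using assms by simp
    show ?thesis
      using False assms integrable_normal_moment_nz_1[OF v, of 0] integral_normal_moment_nz_1[OF v, of 0]
        integrable_normal_moment[OF v, of 0 2] integral_normal_moment_even[OF v, of 0 1]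
      by (simp add: normal_law_def integrable_density integral_density)
  qed
  then show "integrable (normal_law 0 v) (\<lambda>x. x)" "(\<integral>x. x \<partial>normal_law 0 v) = 0"
    "integrable (normal_law 0 v) (\<lambda>x. x\<^sup>2)" "(\<integral>x. x\<^sup>2 \<partial>normal_law 0 v) = v" by auto
qed

text \<open>
Completing the square: tilting a centred normal density by the exponential only shifts its mean.
\<close>

lemma integrable_exp_normal_law:
  assumes "v \<ge> 0"
  shows "integrable (normal_law 0 v) (\<lambda>x. exp x)"
proof (cases "v = 0")
  case True
  then show ?thesis by (simp add: normal_law_def integrable_iff_bounded nn_integral_return)
next
  case False
  then have v: "v > 0" "sqrt v > 0" using assms by auto
  have "normal_density 0 (sqrt v) x * exp x = exp (v / 2) * normal_density v (sqrt v) x" for x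
  proof -
    have "x - x\<^sup>2 / (2 * v) = v / 2 - (x - v)\<^sup>2 / (2 * v)"
      using v by (simp add: field_simps power2_eq_square)
    then show ?thesis
      using v by (simp add: normal_density_def flip: exp_add)
  qed
  then show ?thesis
    using v by (simp add: normal_law_def integrable_density)
qed

text \<open>
Nonnegativity of \<open>v\<close> is part of the conclusion: a characteristic function is bounded by \<open>1\<close>.
\<close>

lemma (in prob_space) normal_law_of_char:
  assumes [measurable]: "R \<in> borel_measurable M"
    and char: "\<And>s. (\<integral>\<omega>. iexp (s * R \<omega>) \<partial>M) = exp (- (s\<^sup>2 * v) / 2)"
  shows "v \<ge> 0" and "distr M borel R = normal_law 0 v"
proof -
  have "norm (\<integral>\<omega>. iexp (1 * R \<omega>) \<partial>M) \<le> (\<integral>\<omega>. norm (iexp (1 * R \<omega>)) \<partial>M)"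
    by (rule integral_norm_bound)
  also have "\<dots> = 1" by (simp add: prob_space)
  finally have "exp (- v / 2) \<le> 1" unfolding char by simp
  then show v: "v \<ge> 0" by simp
  interpret N: prob_space "normal_law 0 v" by (rule prob_space_normal_law[OF v])
  interpret D: prob_space "distr M borel R" by (rule prob_space_distr) simp
  show "distr M borel R = normal_law 0 v"
  proof (rule Levy_uniqueness)
    show "real_distribution (distr M borel R)"
      using D.prob_space_axioms by (auto simp: real_distribution_def real_distribution_axioms_def)
    show "real_distribution (normal_law 0 v)"
      using N.prob_space_axioms by (auto simp: real_distribution_def real_distribution_axioms_def)
    show "char (distr M borel R) = char (normal_law 0 v)"
    proof
      fix s
      have "char (distr M borel R) s = (\<integral>\<omega>. iexp (s * R \<omega>) \<partial>M)"
        unfolding char_def by (subst integral_distr) auto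
      then show "char (distr M borel R) s = char (normal_law 0 v) s"
        unfolding char char_normal_law_0[OF v] .
    qed
  qed
qed

lemma (in prob_space) normal_law_moments:
  assumes [measurable]: "R \<in> borel_measurable M" and "v \<ge> 0" and D: "distr M borel R = normal_law 0 v"
  shows "integrable M R" "(\<integral>\<omega>. R \<omega> \<partial>M) = 0"
    "integrable M (\<lambda>\<omega>. (R \<omega>)\<^sup>2)" "(\<integral>\<omega>. (R \<omega>)\<^sup>2 \<partial>M) = v"
    "integrable M (\<lambda>\<omega>. exp (R \<omega>))"
  using normal_law_0_moments[OF \<open>v \<ge> 0\<close>] integrable_exp_normal_law[OF \<open>v \<ge> 0\<close>]
  unfolding D[symmetric] by (simp_all add: integral_distr integrable_distr_eq)

text \<open>
The hypotheses say that the characteristic function of \<open>(R, T)\<close> factorises along \<open>T\<close>-frequency \<open>1\<close>.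
So the centred phase \<open>exp(iT) - c\<close>, taken as a weight, has vanishing Fourier transform in \<open>R\<close> and
annihilates every integrable function of \<open>R\<close>, in particular \<open>R\<close> itself and \<open>R\<^sup>2 - v\<close>, both of mean
zero.
\<close>

lemma (in prob_space) uncorrelated_gaussian_factor:
  assumes R[measurable]: "R \<in> borel_measurable M" and T[measurable]: "T \<in> borel_measurable M"
    and char_R: "\<And>s. (\<integral>\<omega>. iexp (s * R \<omega>) \<partial>M) = exp (- (s\<^sup>2 * v) / 2)"
    and char_RT: "\<And>s. (\<integral>\<omega>. iexp (s * R \<omega> + T \<omega>) \<partial>M) = exp (- (s\<^sup>2 * v) / 2) * c"
  shows "(\<integral>\<omega>. complex_of_real (R \<omega>) * iexp (T \<omega>) \<partial>M) = 0"
    and "(\<integral>\<omega>. complex_of_real ((R \<omega>)\<^sup>2 - v) * iexp (T \<omega>) \<partial>M) = 0"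
proof -
  note law = normal_law_of_char[OF R char_R]
  note mom = normal_law_moments[OF R law]
  have intT: "integrable M (\<lambda>\<omega>. iexp (T \<omega>))"
    using integrable_mult_iexp[of "\<lambda>_. 1" T] by simp
  have c: "(\<integral>\<omega>. iexp (T \<omega>) \<partial>M) = c" using char_RT[of 0] by simp
  define W where "W = (\<lambda>\<omega>. iexp (T \<omega>) - c)"
  have W: "integrable M W" using intT by (simp add: W_def)
  have W0: "(\<integral>\<omega>. W \<omega> * iexp (s \<bullet> R \<omega>) \<partial>M) = 0" for s
  proof -
    have "integrable M (\<lambda>\<omega>. iexp (T \<omega>) * iexp (s * R \<omega>))"
         "integrable M (\<lambda>\<omega>. c * iexp (s * R \<omega>))"
      using intT by (auto intro!: integrable_mult_iexp simp del: of_real_mult)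
    then show ?thesis
      using char_RT[of s] char_R[of s]
      by (simp add: W_def left_diff_distrib exp_add ring_distribs mult.commute[of "iexp (T _)"])
  qed
  \<comment> \<open>The centred phase annihilates every integrable function of \<open>R\<close>; for those of mean zero the
    centring constant contributes nothing.\<close>
  have ann: "(\<integral>\<omega>. complex_of_real (\<phi> (R \<omega>)) * iexp (T \<omega>) \<partial>M) = 0"
    if \<phi>[measurable]: "\<phi> \<in> borel_measurable borel" and int: "integrable M (\<lambda>\<omega>. \<phi> (R \<omega>))"
      and mean: "(\<integral>\<omega>. \<phi> (R \<omega>) \<partial>M) = 0" for \<phi> :: "real \<Rightarrow> real"
  proof -
    have [measurable]: "W \<in> borel_measurable M" using W by auto
    have int': "integrable M (\<lambda>\<omega>. complex_of_real (\<phi> (R \<omega>)) * iexp (T \<omega>))"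
      using int by (intro integrable_mult_iexp) auto
    then have intW: "integrable M (\<lambda>\<omega>. complex_of_real (\<phi> (R \<omega>)) * W \<omega>)"
      using int by (simp add: W_def right_diff_distrib)
    have "(\<integral>\<omega>. \<phi> (R \<omega>) * Re (W \<omega>) \<partial>M) = 0" "(\<integral>\<omega>. \<phi> (R \<omega>) * Im (W \<omega>) \<partial>M) = 0"
      using zero_fourier_transform_Re_Im[OF W R W0] W intW[THEN integrable_Re] intW[THEN integrable_Im]
      by (auto intro!: zero_fourier_transform_real[where Y = R and \<phi> = \<phi>])
    then have "(\<integral>\<omega>. complex_of_real (\<phi> (R \<omega>)) * W \<omega> \<partial>M) = 0"
      using intW by (intro complex_eqI) (simp_all flip: integral_Re integral_Im)
    moreover have "(\<integral>\<omega>. complex_of_real (\<phi> (R \<omega>)) * W \<omega> \<partial>M)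
        = (\<integral>\<omega>. complex_of_real (\<phi> (R \<omega>)) * iexp (T \<omega>) \<partial>M)"
      using int' int mean by (simp add: W_def right_diff_distrib)
    ultimately show ?thesis by simp
  qed
  show "(\<integral>\<omega>. complex_of_real (R \<omega>) * iexp (T \<omega>) \<partial>M) = 0"
    using ann[of "\<lambda>r. r"] mom by simp
  show "(\<integral>\<omega>. complex_of_real ((R \<omega>)\<^sup>2 - v) * iexp (T \<omega>) \<partial>M) = 0"
    using ann[of "\<lambda>r. r\<^sup>2 - v"] mom by (simp add: prob_space)
qed

section \<open>Independence and iterated expectations\<close>

text \<open>
Independence of two classes of events in the form of a product law, for variables that may take
values in different types.
\<close>

lemma (in prob_space) distr_pair_of_indep_set:
  assumes indep: "indep_set \<A> \<B>"
    and X: "\<And>C. C \<in> sets S \<Longrightarrow> X -` C \<inter> space M \<in> \<A>" "X \<in> space M \<rightarrow> space S"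
    and Y: "\<And>C. C \<in> sets T \<Longrightarrow> Y -` C \<inter> space M \<in> \<B>" "Y \<in> space M \<rightarrow> space T"
  shows "distr M S X \<Otimes>\<^sub>M distr M T Y = distr M (S \<Otimes>\<^sub>M T) (\<lambda>\<omega>. (X \<omega>, Y \<omega>))"
proof -
  have "\<A> \<subseteq> events" "\<B> \<subseteq> events"
    using indep unfolding indep_set_def indep_sets_def by (auto split: bool.splits)
  then have [measurable]: "X \<in> measurable M S" "Y \<in> measurable M T"
    using X Y by (auto intro!: measurableI)
  interpret X: prob_space "distr M S X" by (rule prob_space_distr) simp
  interpret Y: prob_space "distr M T Y" by (rule prob_space_distr) simp
  show ?thesis
  proof (rule pair_measure_eqI)
    fix A B assume "A \<in> sets (distr M S X)" "B \<in> sets (distr M T Y)"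
    then have [measurable]: "A \<in> sets S" "B \<in> sets T" by auto
    have "(\<lambda>\<omega>. (X \<omega>, Y \<omega>)) -` (A \<times> B) \<inter> space M
        = (X -` A \<inter> space M) \<inter> (Y -` B \<inter> space M)" by auto
    then have "prob ((\<lambda>\<omega>. (X \<omega>, Y \<omega>)) -` (A \<times> B) \<inter> space M)
        = prob (X -` A \<inter> space M) * prob (Y -` B \<inter> space M)"
      using indep_setD[OF indep X(1) Y(1)] by simp
    then show "emeasure (distr M S X) A * emeasure (distr M T Y) B
        = emeasure (distr M (S \<Otimes>\<^sub>M T) (\<lambda>\<omega>. (X \<omega>, Y \<omega>))) (A \<times> B)"
      by (simp add: emeasure_distr emeasure_eq_measure ennreal_mult)
  qed (auto intro: X.sigma_finite_measure_axioms Y.sigma_finite_measure_axioms)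
qed

lemma (in prob_space) integral_indep_iterated:
  fixes G :: "'b \<Rightarrow> 'c \<Rightarrow> 'd::{banach,second_countable_topology}"
  assumes X[measurable]: "X \<in> measurable M S" and Y[measurable]: "Y \<in> measurable M T"
    and distr: "distr M S X \<Otimes>\<^sub>M distr M T Y = distr M (S \<Otimes>\<^sub>M T) (\<lambda>\<omega>. (X \<omega>, Y \<omega>))"
    and G[measurable]: "case_prod G \<in> borel_measurable (S \<Otimes>\<^sub>M T)"
    and int: "integrable M (\<lambda>\<omega>. G (X \<omega>) (Y \<omega>))"
  shows "(\<integral>\<omega>. G (X \<omega>) (Y \<omega>) \<partial>M) = (\<integral>\<omega>. (\<integral>\<omega>'. G (X \<omega>) (Y \<omega>') \<partial>M) \<partial>M)"
proof -
  interpret X: prob_space "distr M S X" by (rule prob_space_distr) simp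
  interpret Y: prob_space "distr M T Y" by (rule prob_space_distr) simp
  interpret pair_sigma_finite "distr M S X" "distr M T Y" ..
  have "integrable (distr M S X \<Otimes>\<^sub>M distr M T Y) (case_prod G)"
    unfolding distr using int by (simp add: integrable_distr_eq)
  from integral_fst'[OF this]
  have "(\<integral>x. (\<integral>y. G x y \<partial>distr M T Y) \<partial>distr M S X)
      = (\<integral>z. case_prod G z \<partial>(distr M S X \<Otimes>\<^sub>M distr M T Y))"
    by simp
  also have "\<dots> = (\<integral>\<omega>. G (X \<omega>) (Y \<omega>) \<partial>M)"
    unfolding distr by (simp add: integral_distr)
  also have "(\<integral>x. (\<integral>y. G x y \<partial>distr M T Y) \<partial>distr M S X)
      = (\<integral>\<omega>. (\<integral>y. G (X \<omega>) y \<partial>distr M T Y) \<partial>M)"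
    by (subst integral_distr) auto
  also have "\<dots> = (\<integral>\<omega>. (\<integral>\<omega>'. G (X \<omega>) (Y \<omega>') \<partial>M) \<partial>M)"
  proof (rule Bochner_Integration.integral_cong[OF refl])
    fix \<omega> assume "\<omega> \<in> space M"
    then have [measurable]: "G (X \<omega>) \<in> borel_measurable T"
      using measurable_Pair2[OF G, of "X \<omega>"] measurable_space[OF X] by simp
    show "(\<integral>y. G (X \<omega>) y \<partial>distr M T Y) = (\<integral>\<omega>'. G (X \<omega>) (Y \<omega>') \<partial>M)"
      by (subst integral_distr) auto
  qed
  finally show ?thesis by simp
qed

text \<open>
Turns "\<open>\<A>\<close> is independent of \<open>\<B>\<close> and \<open>\<C>\<close> together, and these of each other" into the form needed to
freeze \<open>\<C>\<close>. The intersections of a member of \<open>\<A>\<close> with one of \<open>\<B>\<close> form a generator stable under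
intersection, on which independence is the product formula for three events.
\<close>

lemma (in prob_space) indep_set_regroup:
  assumes A: "sigma_algebra (space M) \<A>" and B: "sigma_algebra (space M) \<B>"
    and C: "sigma_algebra (space M) \<C>"
    and A_BC: "indep_set \<A> (sigma_sets (space M) (\<B> \<union> \<C>))" and BC: "indep_set \<B> \<C>"
  shows "indep_set \<C> (sigma_sets (space M) (\<A> \<union> \<B>))"
proof -
  interpret A: sigma_algebra "space M" \<A> by fact
  interpret B: sigma_algebra "space M" \<B> by fact
  interpret C: sigma_algebra "space M" \<C> by fact
  let ?R = "{a \<inter> b | a b. a \<in> \<A> \<and> b \<in> \<B>}"
  have ev: "\<A> \<subseteq> events" "\<B> \<subseteq> events" "\<C> \<subseteq> events"
    using A_BC BC unfolding indep_set_def indep_sets_def by (auto split: bool.splits)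
  have BC_D: "prob (b \<inter> c) = prob b * prob c" if "b \<in> \<B>" "c \<in> \<C>" for b c
    using BC that by (rule indep_setD)
  have A_D: "prob (a \<inter> d) = prob a * prob d" if "a \<in> \<A>" "d \<in> sigma_sets (space M) (\<B> \<union> \<C>)" for a d
    using A_BC that by (rule indep_setD)
  have "indep_set \<C> ?R"
  proof (rule indep_setI)
    fix c r assume c: "c \<in> \<C>" and "r \<in> ?R"
    then obtain a b where ab: "a \<in> \<A>" "b \<in> \<B>" "r = a \<inter> b" by auto
    interpret BC: sigma_algebra "space M" "sigma_sets (space M) (\<B> \<union> \<C>)"
      using B.space_closed C.space_closed by (intro sigma_algebra_sigma_sets) auto
    have gen: "b \<in> sigma_sets (space M) (\<B> \<union> \<C>)" "c \<in> sigma_sets (space M) (\<B> \<union> \<C>)"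
      using ab c by auto
    have "prob (c \<inter> r) = prob (a \<inter> (b \<inter> c))" by (simp add: ab Int_ac)
    also have "\<dots> = prob a * (prob b * prob c)"
      using ab c gen by (simp add: A_D BC_D BC.Int)
    also have "\<dots> = prob c * prob r" using ab gen by (simp add: A_D)
    finally show "prob (c \<inter> r) = prob c * prob r" .
  qed (use ev in auto)
  moreover have "Int_stable \<C>" by (auto simp: Int_stable_def)
  moreover have "Int_stable ?R"
    unfolding Int_stable_def
  proof safe
    fix a b a' b' assume "a \<in> \<A>" "b \<in> \<B>" "a' \<in> \<A>" "b' \<in> \<B>"
    then show "\<exists>x y. (a \<inter> b) \<inter> (a' \<inter> b') = x \<inter> y \<and> x \<in> \<A> \<and> y \<in> \<B>"
      by (intro exI[of _ "a \<inter> a'"] exI[of _ "b \<inter> b'"]) auto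
  qed
  ultimately have "indep_set (sigma_sets (space M) \<C>) (sigma_sets (space M) ?R)"
    by (rule indep_set_sigma_sets)
  moreover have "sigma_sets (space M) (\<A> \<union> \<B>) = sigma_sets (space M) ?R"
  proof (rule sigma_sets_eqI)
    fix d assume "d \<in> \<A> \<union> \<B>"
    then have "d = d \<inter> space M" "d = space M \<inter> d" "d \<in> \<A> \<or> d \<in> \<B>"
      using A.sets_into_space B.sets_into_space by auto
    then have "d \<in> ?R" using A.top B.top by blast
    then show "d \<in> sigma_sets (space M) ?R" by auto
  next
    fix r assume "r \<in> ?R"
    interpret AB: sigma_algebra "space M" "sigma_sets (space M) (\<A> \<union> \<B>)"
      using A.space_closed B.space_closed by (intro sigma_algebra_sigma_sets) auto
    show "r \<in> sigma_sets (space M) (\<A> \<union> \<B>)" using \<open>r \<in> ?R\<close> by auto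
  qed
  ultimately show ?thesis by (simp add: C.sigma_sets_eq)
qed

section \<open>Gaussian process marginals\<close>

text \<open>
A linear combination of values at possibly repeated points is one at distinct points, with the
coefficients of coinciding points added up. This is how test points that coincide with training
points are treated on a par with the others.
\<close>

lemma quadratic_form_group:
  fixes k :: "'a \<Rightarrow> 'a \<Rightarrow> real" and c :: "'i \<Rightarrow> real" and p :: "'i \<Rightarrow> 'a"
  assumes "finite I"
  defines "C \<equiv> \<lambda>z. \<Sum>i\<in>{i\<in>I. p i = z}. c i"
  shows "(\<Sum>i\<in>I. c i * G (p i)) = (\<Sum>z\<in>p ` I. C z * G z)"
    and "(\<Sum>i\<in>I. \<Sum>j\<in>I. c i * k (p i) (p j) * c j)
      = (\<Sum>z\<in>p ` I. \<Sum>z'\<in>p ` I. C z * k z z' * C z')"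
proof -
  have group: "(\<Sum>i\<in>I. c i * G (p i)) = (\<Sum>z\<in>p ` I. C z * G z)" for G :: "'a \<Rightarrow> real"
    unfolding C_def sum_distrib_right
    by (subst sum.image_gen[OF assms(1), of _ p]) (auto intro!: sum.cong)
  show "(\<Sum>i\<in>I. c i * G (p i)) = (\<Sum>z\<in>p ` I. C z * G z)" by (rule group)
  have "(\<Sum>i\<in>I. \<Sum>j\<in>I. c i * k (p i) (p j) * c j)
      = (\<Sum>i\<in>I. c i * (\<Sum>j\<in>I. c j * k (p i) (p j)))"
    by (simp add: sum_distrib_left mult_ac)
  also have "\<dots> = (\<Sum>z\<in>p ` I. C z * (\<Sum>j\<in>I. c j * k z (p j)))"
    by (rule group)
  also have "\<dots> = (\<Sum>z\<in>p ` I. C z * (\<Sum>z'\<in>p ` I. C z' * k z z'))"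
    by (simp add: group)
  finally show "(\<Sum>i\<in>I. \<Sum>j\<in>I. c i * k (p i) (p j) * c j)
      = (\<Sum>z\<in>p ` I. \<Sum>z'\<in>p ` I. C z * k z z' * C z')"
    by (simp add: sum_distrib_left mult_ac)
qed

lemma zero_mean_gp_measurable:
  assumes "zero_mean_gp M X k f" "z \<in> X"
  shows "f z \<in> borel_measurable M"
  using assms(1)[unfolded zero_mean_gp_def, rule_format, of "\<lambda>_. z" 1] assms(2)
  by (auto simp: multivariate_normal_def inj_on_def)

lemma zero_mean_gp_linear_combination:
  assumes gp: "zero_mean_gp M X k f" and I: "finite I" "p ` I \<subseteq> X"
  shows "distr M borel (\<lambda>\<omega>. \<Sum>i\<in>I. c i * f (p i) \<omega>)
    = normal_law 0 (\<Sum>i\<in>I. \<Sum>j\<in>I. c i * k (p i) (p j) * c j)"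
proof -
  define C where "C z = (\<Sum>i\<in>{i\<in>I. p i = z}. c i)" for z
  obtain q where q: "bij_betw q {1..card (p ` I)} (p ` I)"
    using ex_bij_betw_nat_finite_1[of "p ` I"] I(1) by auto
  have re: "(\<Sum>n\<in>{1..card (p ` I)}. g (q n)) = (\<Sum>z\<in>p ` I. g z)" for g :: "_ \<Rightarrow> real"
    by (rule sum.reindex_bij_betw[OF q])
  have "multivariate_normal M {1..card (p ` I)} (\<lambda>n. f (q n)) (\<lambda>_. 0) (\<lambda>i j. k (q i) (q j))"
    using gp[unfolded zero_mean_gp_def] q I(2) by (auto simp: bij_betw_def)
  then have "distr M borel (\<lambda>\<omega>. \<Sum>n\<in>{1..card (p ` I)}. C (q n) * f (q n) \<omega>)
      = normal_law 0 (\<Sum>i\<in>{1..card (p ` I)}. \<Sum>j\<in>{1..card (p ` I)}. C (q i) * k (q i) (q j) * C (q j))"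
    unfolding multivariate_normal_def by (auto dest!: spec[of _ "\<lambda>n. C (q n)"])
  moreover have "(\<Sum>n\<in>{1..card (p ` I)}. C (q n) * f (q n) \<omega>) = (\<Sum>i\<in>I. c i * f (p i) \<omega>)" for \<omega>
    using re[of "\<lambda>z. C z * f z \<omega>"] quadratic_form_group(1)[OF I(1), of c "\<lambda>z. f z \<omega>" p]
    by (simp add: C_def)
  moreover have "(\<Sum>i\<in>{1..card (p ` I)}. \<Sum>j\<in>{1..card (p ` I)}. C (q i) * k (q i) (q j) * C (q j))
      = (\<Sum>i\<in>I. \<Sum>j\<in>I. c i * k (p i) (p j) * c j)"
    unfolding quadratic_form_group(2)[OF I(1), of c k p] re[symmetric] C_def ..
  ultimately show ?thesis by simp
qed

lemma strictly_pd_kernel_nonneg: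
  assumes pd: "strictly_pd_kernel X k" and I: "finite I" "p ` I \<subseteq> X"
  shows "(\<Sum>i\<in>I. \<Sum>j\<in>I. c i * k (p i) (p j) * c j) \<ge> 0"
    and "inj_on p I \<Longrightarrow> (\<exists>i\<in>I. c i \<noteq> 0) \<Longrightarrow> (\<Sum>i\<in>I. \<Sum>j\<in>I. c i * k (p i) (p j) * c j) > 0"
proof -
  define C where "C z = (\<Sum>i\<in>{i\<in>I. p i = z}. c i)" for z
  obtain q where q: "bij_betw q {1..card (p ` I)} (p ` I)"
    using ex_bij_betw_nat_finite_1[of "p ` I"] I(1) by auto
  have re: "(\<Sum>n\<in>{1..card (p ` I)}. g (q n)) = (\<Sum>z\<in>p ` I. g z)" for g :: "_ \<Rightarrow> real"
    by (rule sum.reindex_bij_betw[OF q])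
  have pd': "positive_definite_on {1..card (p ` I)} (\<lambda>i j. k (q i) (q j))"
    using pd[unfolded strictly_pd_kernel_def] q I(2) by (auto simp: bij_betw_def)
  have eq: "(\<Sum>i\<in>{1..card (p ` I)}. \<Sum>j\<in>{1..card (p ` I)}. C (q i) * k (q i) (q j) * C (q j))
      = (\<Sum>i\<in>I. \<Sum>j\<in>I. c i * k (p i) (p j) * c j)"
    unfolding quadratic_form_group(2)[OF I(1), of c k p] re[symmetric] C_def ..
  have pos: "(\<Sum>i\<in>I. \<Sum>j\<in>I. c i * k (p i) (p j) * c j) > 0" if "\<exists>n\<in>{1..card (p ` I)}. C (q n) \<noteq> 0"
    using pd' that unfolding positive_definite_on_def eq[symmetric] 
    by (auto dest!: spec[of _ "\<lambda>n. C (q n)"])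
  show "(\<Sum>i\<in>I. \<Sum>j\<in>I. c i * k (p i) (p j) * c j) \<ge> 0"
  proof (cases "\<exists>n\<in>{1..card (p ` I)}. C (q n) \<noteq> 0")
    case True
    then show ?thesis using pos by simp
  next
    case False
    then show ?thesis unfolding eq[symmetric] by (auto intro!: sum_nonneg)
  qed
  assume inj: "inj_on p I" and "\<exists>i\<in>I. c i \<noteq> 0"
  then obtain i where i: "i \<in> I" "c i \<noteq> 0" by auto
  have "{j \<in> I. p j = p i} = {i}" using inj i by (auto simp: inj_on_def)
  then have "C (p i) \<noteq> 0" using i by (simp add: C_def)
  moreover obtain n where "n \<in> {1..card (p ` I)}" "q n = p i"
    using q i unfolding bij_betw_def by (metis image_iff)
  ultimately show "(\<Sum>i\<in>I. \<Sum>j\<in>I. c i * k (p i) (p j) * c j) > 0"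
    by (intro pos bexI[of _ n]) simp_all
qed

lemma strictly_pd_kernel_sym:
  assumes pd: "strictly_pd_kernel X k" and "a \<in> X" "b \<in> X"
  shows "k a b = k b a"
proof (cases "a = b")
  case False
  have "{1..2::nat} = {1, 2}" by auto
  then have "inj_on (\<lambda>n::nat. if n = 1 then a else b) {1..2}" "(\<lambda>n::nat. if n = 1 then a else b) ` {1..2} \<subseteq> X"
    using False assms by (auto simp: inj_on_def)
  then have "positive_definite_on {1..2::nat} (\<lambda>i j. k (if i = 1 then a else b) (if j = 1 then a else b))"
    using pd unfolding strictly_pd_kernel_def by blast
  then have "\<forall>i\<in>{1..2::nat}. \<forall>j\<in>{1..2::nat}. k (if i = 1 then a else b) (if j = 1 then a else b)
      = k (if j = 1 then a else b) (if i = 1 then a else b)"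
    unfolding positive_definite_on_def by blast
  from this[rule_format, of 1 2] show ?thesis by simp
qed simp

lemma (in prob_space) char_std_normal_combination:
  assumes I: "finite I" and indep: "indep_vars (\<lambda>_. borel) u I"
    and normal: "\<And>i. i \<in> I \<Longrightarrow> distributed M lborel (u i) std_normal_density"
  shows "(\<integral>\<omega>. iexp (\<Sum>i\<in>I. c i * u i \<omega>) \<partial>M) = exp (- (\<Sum>i\<in>I. (c i)\<^sup>2) / 2)"
proof -
  have u: "u i \<in> borel_measurable M" "distr M borel (u i) = std_normal_distribution" if "i \<in> I" for i
    using normal[OF that] by (auto simp: distributed_def cong: distr_cong)
  have indep': "indep_vars (\<lambda>_. borel) (\<lambda>i \<omega>. c i * u i \<omega>) I"
    using indep by (rule indep_vars_compose2) auto
  have "(\<integral>\<omega>. iexp (\<Sum>i\<in>I. c i * u i \<omega>) \<partial>M)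
      = char (distr M borel (\<lambda>\<omega>. \<Sum>i\<in>I. c i * u i \<omega>)) 1"
    unfolding char_def using u by (subst integral_distr) (auto intro!: borel_measurable_sum)
  also have "\<dots> = (\<Prod>i\<in>I. char (distr M borel (\<lambda>\<omega>. c i * u i \<omega>)) 1)"
    by (rule char_distr_sum[OF indep'])
  also have "\<dots> = (\<Prod>i\<in>I. complex_of_real (exp (- (c i)\<^sup>2 / 2)))"
  proof (rule prod.cong[OF refl])
    fix i assume i: "i \<in> I"
    note [measurable] = u(1)[OF i]
    have "char (distr M borel (\<lambda>\<omega>. c i * u i \<omega>)) 1 = char (distr M borel (u i)) (c i)"
      unfolding char_def by (simp add: integral_distr)
    then show "char (distr M borel (\<lambda>\<omega>. c i * u i \<omega>)) 1 = complex_of_real (exp (- (c i)\<^sup>2 / 2))"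
      by (simp add: u(2)[OF i] char_std_normal_distribution)
  qed
  also have "\<dots> = exp (- (\<Sum>i\<in>I. (c i)\<^sup>2) / 2)"
    using I by (simp add: exp_sum[symmetric] sum_negf sum_divide_distrib flip: of_real_prod)
  finally show ?thesis .
qed

section \<open>Positive definite matrices\<close>

lemma matrix_inv_inverse:
  fixes A :: "real ^ 'd ^ 'd"
  assumes "invertible A"
  shows "A ** matrix_inv A = mat 1" "matrix_inv A ** A = mat 1"
  using someI_ex[OF assms[unfolded invertible_def]] by (auto simp: matrix_inv_def)

text \<open>
The bound on the inverse depends on \<open>A\<close> only through \<open>c\<close>; it is what makes the inverse of a random
matrix bounded.
\<close>

lemma coercive_matrix_inv:
  fixes A :: "real ^ 'd ^ 'd"
  assumes c: "c > 0" and A: "\<And>u. u \<bullet> (A *v u) \<ge> c * (norm u)\<^sup>2"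
  shows "A ** matrix_inv A = mat 1" "matrix_inv A ** A = mat 1" "det A \<noteq> 0"
    "norm (matrix_inv A *v u) \<le> norm u / c"
proof -
  have "u = 0" if "A *v u = 0" for u
    using A[of u] that c by (simp add: mult_le_0_iff)
  then have inv: "invertible A"
    using matrix_left_invertible_ker invertible_left_inverse by blast
  then show AI: "A ** matrix_inv A = mat 1" "matrix_inv A ** A = mat 1"
    using matrix_inv_inverse[OF inv] by auto
  show "det A \<noteq> 0" using inv invertible_det_nz by blast
  let ?w = "matrix_inv A *v u"
  have "A *v ?w = u" by (simp add: matrix_vector_mul_assoc AI)
  then have "c * (norm ?w)\<^sup>2 \<le> norm ?w * norm u"
    using A[of ?w] norm_cauchy_schwarz[of ?w u] by simp
  then have "norm ?w * (c * norm ?w) \<le> norm ?w * norm u"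
    by (simp add: power2_eq_square mult_ac)
  then have "c * norm ?w \<le> norm u"
    by (cases "norm ?w = 0") auto
  then show "norm ?w \<le> norm u / c" using c by (simp add: field_simps)
qed

text \<open>
The constant is the minimum of the quadratic form on the unit sphere.
\<close>

lemma positive_definite_coercive:
  fixes A :: "real ^ 'd ^ 'd"
  assumes pos: "\<And>u. u \<noteq> 0 \<Longrightarrow> u \<bullet> (A *v u) > 0"
  obtains c where "c > 0" "\<And>u. u \<bullet> (A *v u) \<ge> c * (norm u)\<^sup>2"
proof -
  have "continuous_on (sphere 0 1) (\<lambda>u. u \<bullet> (A *v u))"
    by (intro continuous_intros linear_continuous_on linear_linear[THEN iffD1] matrix_vector_mul_linear)
  moreover have "sphere (0 :: real ^ 'd) 1 \<noteq> {}" by simp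
  ultimately obtain w where w: "w \<in> sphere 0 1" "\<forall>u\<in>sphere 0 1. w \<bullet> (A *v w) \<le> u \<bullet> (A *v u)"
    using continuous_attains_inf[of "sphere (0 :: real ^ 'd) 1" "\<lambda>u. u \<bullet> (A *v u)"] by auto
  show thesis
  proof
    show "w \<bullet> (A *v w) > 0" using pos[of w] w(1) by (cases "w = 0") auto
    fix u :: "real ^ 'd"
    show "u \<bullet> (A *v u) \<ge> w \<bullet> (A *v w) * (norm u)\<^sup>2"
    proof (cases "u = 0")
      case False
      \<comment> \<open>The form is homogeneous of degree two.\<close>
      let ?e = "u /\<^sub>R norm u"
      have "?e \<in> sphere 0 1" using False by simp
      from w(2)[rule_format, OF this] have "w \<bullet> (A *v w) \<le> (u \<bullet> (A *v u)) / (norm u)\<^sup>2"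
        by (simp add: matrix_vector_mult_scaleR power2_eq_square divide_simps)
      then show ?thesis using False by (simp add: field_simps)
    qed simp
  qed
qed

lemma symmetric_matrix_inv:
  fixes A :: "real ^ 'd ^ 'd"
  assumes "transpose A = A" and inv: "A ** matrix_inv A = mat 1" "matrix_inv A ** A = mat 1"
  shows "transpose (matrix_inv A) = matrix_inv A"
proof -
  have "transpose (A ** matrix_inv A) = mat 1" using inv by (simp add: transpose_mat)
  then have "transpose (matrix_inv A) ** A = mat 1" by (simp add: matrix_transpose_mul assms(1))
  then have "(transpose (matrix_inv A) ** A) ** matrix_inv A = matrix_inv A" by simp
  then show ?thesis by (simp add: matrix_mul_assoc[symmetric] inv)
qed

text \<open>
By Cramer's rule the entries of the inverse are rational functions of the entries of the matrix.
\<close>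

lemma borel_measurable_matrix_inv_entry:
  fixes A :: "'w \<Rightarrow> real ^ 'd ^ 'd"
  assumes A: "\<And>i j. (\<lambda>\<omega>. A \<omega> $ i $ j) \<in> borel_measurable M"
    and det: "\<And>\<omega>. det (A \<omega>) \<noteq> 0"
  shows "(\<lambda>\<omega>. matrix_inv (A \<omega>) $ i $ j) \<in> borel_measurable M"
proof -
  have eq: "matrix_inv (A \<omega>) $ i $ j
      = det (\<chi> i' j'. if j' = i then axis j 1 $ i' else A \<omega> $ i' $ j') / det (A \<omega>)" for \<omega>
  proof -
    have "A \<omega> *v (matrix_inv (A \<omega>) *v axis j 1) = axis j 1"
      using matrix_inv_inverse(1)[of "A \<omega>"] det[of \<omega>]
      by (simp add: matrix_vector_mul_assoc invertible_det_nz)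
    then have "(matrix_inv (A \<omega>) *v axis j 1) $ i
        = det (\<chi> i' j'. if j' = i then axis j 1 $ i' else A \<omega> $ i' $ j') / det (A \<omega>)"
      using cramer[OF det[of \<omega>], of "matrix_inv (A \<omega>) *v axis j 1" "axis j 1"] by simp
    then show ?thesis by (simp add: matrix_vector_mult_basis column_def)
  qed
  have m: "(\<lambda>\<omega>. if b then x else A \<omega> $ i $ j) \<in> borel_measurable M" for b x i j
    using A by (cases b) auto
  show ?thesis
    unfolding eq det_def
    by (intro borel_measurable_divide borel_measurable_sum borel_measurable_times borel_measurable_prod)
       (auto intro: A m)
qed

section \<open>Conditional second moments\<close>

lemma borel_measurable_vecI:
  fixes f :: "'w \<Rightarrow> real ^ 'd"
  assumes "\<And>i. (\<lambda>\<omega>. f \<omega> $ i) \<in> borel_measurable M"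
  shows "f \<in> borel_measurable M"
  using assms by (subst borel_measurable_euclidean_space) (auto simp: Basis_vec_def inner_axis)

lemma measurable_vec_nth[measurable (raw)]:
  fixes f :: "'w \<Rightarrow> real ^ 'd"
  assumes "f \<in> borel_measurable M"
  shows "(\<lambda>\<omega>. f \<omega> $ i) \<in> borel_measurable M"
  by (rule measurable_compose[OF assms])
     (intro borel_measurable_continuous_onI continuous_intros)

lemma integrable_product_of_squares:
  fixes f g :: "'w \<Rightarrow> real"
  assumes [measurable]: "f \<in> borel_measurable M" "g \<in> borel_measurable M"
    and "integrable M (\<lambda>\<omega>. (f \<omega>)\<^sup>2)" "integrable M (\<lambda>\<omega>. (g \<omega>)\<^sup>2)"
  shows "integrable M (\<lambda>\<omega>. f \<omega> * g \<omega>)"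
proof (rule Bochner_Integration.integrable_bound)
  show "integrable M (\<lambda>\<omega>. (f \<omega>)\<^sup>2 + (g \<omega>)\<^sup>2)" using assms by simp
  have "\<bar>a\<bar> * \<bar>b\<bar> \<le> a\<^sup>2 + b\<^sup>2" for a b :: real
  proof -
    have "2 * (\<bar>a\<bar> * \<bar>b\<bar>) \<le> a\<^sup>2 + b\<^sup>2" "0 \<le> \<bar>a\<bar> * \<bar>b\<bar>"
      using sum_squares_bound[of "\<bar>a\<bar>" "\<bar>b\<bar>"] by (simp_all add: mult.assoc)
    then show ?thesis by linarith
  qed
  then show "AE \<omega> in M. norm (f \<omega> * g \<omega>) \<le> norm ((f \<omega>)\<^sup>2 + (g \<omega>)\<^sup>2)"
    by (simp add: abs_mult)
qed measurable

text \<open>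
The cross term is handled by pulling the conditional mean out of the conditional expectation; this
needs its square to be integrable, which is Jensen's inequality.
\<close>

lemma (in prob_space) cond_variance_eq:
  assumes sub: "subalgebra M F" and [measurable]: "Z \<in> borel_measurable M"
    and Z2: "integrable M (\<lambda>\<omega>. (Z \<omega>)\<^sup>2)"
  shows "AE \<omega> in M. cond_variance M F Z \<omega>
    = real_cond_exp M F (\<lambda>\<omega>. (Z \<omega>)\<^sup>2) \<omega> - (real_cond_exp M F Z \<omega>)\<^sup>2"
proof -
  interpret F: finite_measure_subalgebra M F
    by (intro finite_measure_subalgebra.intro finite_measure_axioms
        finite_measure_subalgebra_axioms.intro sub)
  have Z: "integrable M Z" using Z2 by (rule square_integrable_imp_integrable[rotated]) simp
  define g where "g = real_cond_exp M F Z"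
  have gF[measurable]: "g \<in> borel_measurable F" by (simp add: g_def)
  have [measurable]: "g \<in> borel_measurable M" by (simp add: g_def)
  have g2: "integrable M (\<lambda>\<omega>. (g \<omega>)\<^sup>2)"
    unfolding g_def
    by (rule F.integrable_convex_cond_exp[where X = Z and I = UNIV and q = "\<lambda>z. z\<^sup>2"])
       (use Z Z2 convex_power2 in auto)
  have gZ: "integrable M (\<lambda>\<omega>. g \<omega> * Z \<omega>)"
    using g2 Z2 by (intro integrable_product_of_squares) auto
  have eq: "(\<lambda>\<omega>. (Z \<omega> - g \<omega>)\<^sup>2) = (\<lambda>\<omega>. ((Z \<omega>)\<^sup>2 - 2 * (g \<omega> * Z \<omega>)) + (g \<omega>)\<^sup>2)"
    by (simp add: fun_eq_iff power2_eq_square algebra_simps)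
  have "AE \<omega> in M. real_cond_exp M F (\<lambda>\<omega>. ((Z \<omega>)\<^sup>2 - 2 * (g \<omega> * Z \<omega>)) + (g \<omega>)\<^sup>2) \<omega>
      = real_cond_exp M F (\<lambda>\<omega>. (Z \<omega>)\<^sup>2 - 2 * (g \<omega> * Z \<omega>)) \<omega> + real_cond_exp M F (\<lambda>\<omega>. (g \<omega>)\<^sup>2) \<omega>"
    using Z2 gZ g2 by (intro F.real_cond_exp_add) auto
  moreover have "AE \<omega> in M. real_cond_exp M F (\<lambda>\<omega>. (Z \<omega>)\<^sup>2 - 2 * (g \<omega> * Z \<omega>)) \<omega>
      = real_cond_exp M F (\<lambda>\<omega>. (Z \<omega>)\<^sup>2) \<omega> - real_cond_exp M F (\<lambda>\<omega>. 2 * (g \<omega> * Z \<omega>)) \<omega>"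
    using Z2 gZ by (intro F.real_cond_exp_diff) auto
  moreover have "AE \<omega> in M. real_cond_exp M F (\<lambda>\<omega>. 2 * (g \<omega> * Z \<omega>)) \<omega>
      = 2 * real_cond_exp M F (\<lambda>\<omega>. g \<omega> * Z \<omega>) \<omega>"
    using gZ by (rule F.real_cond_exp_cmult)
  moreover have "AE \<omega> in M. real_cond_exp M F (\<lambda>\<omega>. g \<omega> * Z \<omega>) \<omega> = g \<omega> * real_cond_exp M F Z \<omega>"
    using gZ by (intro F.real_cond_exp_mult) auto
  moreover have "AE \<omega> in M. real_cond_exp M F (\<lambda>\<omega>. (g \<omega>)\<^sup>2) \<omega> = (g \<omega>)\<^sup>2"
    using g2 by (intro F.real_cond_exp_F_meas) auto
  ultimately show ?thesis
    unfolding cond_variance_def g_def[symmetric] eq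
    by eventually_elim (simp add: power2_eq_square flip: g_def)
qed

lemma (in prob_space) cond_exp_matrix_bilinear:
  fixes A :: "'a \<Rightarrow> real ^ 'd::finite ^ 'e::finite"
  assumes sub: "subalgebra M \<F>"
    and A: "\<And>i j. (\<lambda>\<omega>. A \<omega> $ i $ j) \<in> borel_measurable M"
    and z: "z \<in> borel_measurable \<F>"
    and int: "\<And>i j. integrable M (\<lambda>\<omega>. z \<omega> $ j * A \<omega> $ i $ j)"
  shows "AE \<omega> in M. real_cond_exp M \<F> (\<lambda>\<omega>. u \<bullet> (A \<omega> *v z \<omega>)) \<omega>
    = u \<bullet> (cond_exp_matrix M \<F> A \<omega> *v z \<omega>)"
proof -
  interpret \<F>: finite_measure_subalgebra M \<F>
    by (intro finite_measure_subalgebra.intro finite_measure_axioms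
        finite_measure_subalgebra_axioms.intro sub)
  have eq: "(\<lambda>\<omega>. u \<bullet> (A \<omega> *v z \<omega>)) = (\<lambda>\<omega>. \<Sum>i\<in>UNIV. \<Sum>j\<in>UNIV. u $ i * (z \<omega> $ j * A \<omega> $ i $ j))"
    by (simp add: fun_eq_iff inner_vec_def matrix_vector_mult_def sum_distrib_left mult_ac)
  have "AE \<omega> in M. real_cond_exp M \<F> (\<lambda>\<omega>. \<Sum>i\<in>UNIV. \<Sum>j\<in>UNIV. u $ i * (z \<omega> $ j * A \<omega> $ i $ j)) \<omega>
      = (\<Sum>i\<in>UNIV. real_cond_exp M \<F> (\<lambda>\<omega>. \<Sum>j\<in>UNIV. u $ i * (z \<omega> $ j * A \<omega> $ i $ j)) \<omega>)"
    using int by (intro \<F>.real_cond_exp_sum) auto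
  moreover have "AE \<omega> in M. \<forall>i. real_cond_exp M \<F> (\<lambda>\<omega>. \<Sum>j\<in>UNIV. u $ i * (z \<omega> $ j * A \<omega> $ i $ j)) \<omega>
      = (\<Sum>j\<in>UNIV. real_cond_exp M \<F> (\<lambda>\<omega>. u $ i * (z \<omega> $ j * A \<omega> $ i $ j)) \<omega>)"
    unfolding AE_all_countable using int by (intro allI \<F>.real_cond_exp_sum) auto
  moreover have "AE \<omega> in M. \<forall>i. \<forall>j. real_cond_exp M \<F> (\<lambda>\<omega>. u $ i * (z \<omega> $ j * A \<omega> $ i $ j)) \<omega>
      = u $ i * real_cond_exp M \<F> (\<lambda>\<omega>. z \<omega> $ j * A \<omega> $ i $ j) \<omega>"
    unfolding AE_all_countable using int by auto
  moreover have "AE \<omega> in M. \<forall>i. \<forall>j. real_cond_exp M \<F> (\<lambda>\<omega>. z \<omega> $ j * A \<omega> $ i $ j) \<omega>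
      = z \<omega> $ j * real_cond_exp M \<F> (\<lambda>\<omega>. A \<omega> $ i $ j) \<omega>"
    unfolding AE_all_countable
    by (intro allI \<F>.real_cond_exp_mult measurable_vec_nth[OF z] A int)
  ultimately show ?thesis
    unfolding eq
    by eventually_elim
      (simp add: cond_exp_matrix_def inner_vec_def matrix_vector_mult_def sum_distrib_left mult_ac)
qed

lemma outer_mult: "outer a b *v z = (b \<bullet> z) *\<^sub>R a"
  by (simp add: outer_def matrix_vector_mult_def inner_vec_def vec_eq_iff sum_distrib_left mult_ac)

section \<open>Regression with random noise levels\<close>

text \<open>
Multiplication by the diagonal matrix of standard deviations \<open>exp(e\<^sub>i / 2)\<close>.
\<close>

definition noise_scale :: "real ^ 'd \<Rightarrow> real ^ 'd \<Rightarrow> real ^ 'd" where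
  "noise_scale e u = (\<chi> i. exp (e $ i / 2) * u $ i)"

lemma inner_noise_scale: "t \<bullet> noise_scale e u = noise_scale e t \<bullet> u"
  by (simp add: noise_scale_def inner_vec_def mult_ac)

lemma linear_noise_scale:
  "noise_scale e (t - s *\<^sub>R a) = noise_scale e t - s *\<^sub>R noise_scale e a"
  by (simp add: noise_scale_def vec_eq_iff algebra_simps)

lemma measurable_noise_scale[measurable (raw)]:
  assumes "f \<in> borel_measurable M" "g \<in> borel_measurable M"
  shows "(\<lambda>\<omega>. noise_scale (f \<omega>) (g \<omega>)) \<in> borel_measurable M"
  using assms by (intro borel_measurable_vecI) (simp add: noise_scale_def)

text \<open>
The abstract situation: \<open>f0\<close> is the value to be predicted, \<open>F\<close> the signal at the training inputs,
\<open>U\<close> the averaged normalised noise and \<open>\<eta>\<close> the log noise variances. That \<open>(f0, F, U)\<close> is centred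
Gaussian is expressed by its characteristic function, which encodes the covariances
\<open>kxx\<close>, \<open>kx\<close> and \<open>K\<close> of the signal, the variance \<open>1 / n\<close> of each component of the noise and the
independence of signal and noise.
\<close>

locale heteroscedastic_regression = prob_space M
  for M :: "'w measure" +
  fixes f0 :: "'w \<Rightarrow> real" and F U \<eta> Y :: "'w \<Rightarrow> real ^ 'd"
    and K :: "real ^ 'd ^ 'd" and kx :: "real ^ 'd" and kxx n \<kappa> :: real
  assumes f0[measurable]: "f0 \<in> borel_measurable M"
    and F[measurable]: "F \<in> borel_measurable M"
    and U[measurable]: "U \<in> borel_measurable M"
    and \<eta>[measurable]: "\<eta> \<in> borel_measurable M"
    and char_signal_noise: "\<And>\<alpha> b c. (\<integral>\<omega>. iexp (\<alpha> * f0 \<omega> + b \<bullet> F \<omega> + c \<bullet> U \<omega>) \<partial>M)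
      = exp (- (\<alpha>\<^sup>2 * kxx + 2 * \<alpha> * (b \<bullet> kx) + b \<bullet> (K *v b) + (c \<bullet> c) / n) / 2)"
    and indep: "distr M borel \<eta> \<Otimes>\<^sub>M distr M (borel \<Otimes>\<^sub>M borel \<Otimes>\<^sub>M borel) (\<lambda>\<omega>. (f0 \<omega>, F \<omega>, U \<omega>))
      = distr M (borel \<Otimes>\<^sub>M borel \<Otimes>\<^sub>M borel \<Otimes>\<^sub>M borel) (\<lambda>\<omega>. (\<eta> \<omega>, f0 \<omega>, F \<omega>, U \<omega>))"
    and exp_\<eta>: "\<And>i. integrable M (\<lambda>\<omega>. exp (\<eta> \<omega> $ i))"
    and Y_eq: "\<And>\<omega>. \<omega> \<in> space M \<Longrightarrow> Y \<omega> = F \<omega> + noise_scale (\<eta> \<omega>) (U \<omega>)"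
    and K_sym: "transpose K = K"
    and \<kappa>: "\<kappa> > 0" and K_coercive: "\<And>u. u \<bullet> (K *v u) \<ge> \<kappa> * (norm u)\<^sup>2"
    and n: "n > 0"
begin

subsection \<open>The covariance of the data\<close>

definition noisy_cov :: "real ^ 'd \<Rightarrow> real ^ 'd ^ 'd" where
  "noisy_cov e = K + (1 / n) *\<^sub>R (\<chi> i j. if i = j then exp (e $ i) else 0)"

text \<open>
The regression coefficients of \<open>f0\<close> on the data at noise level \<open>e\<close>.
\<close>

definition gain :: "real ^ 'd \<Rightarrow> real ^ 'd" where
  "gain e = matrix_inv (noisy_cov e) *v kx"

text \<open>
The Schur complement of \<open>noisy_cov e\<close> in the joint covariance of \<open>f0\<close> and the data.
\<close>

definition residual_var :: "real ^ 'd \<Rightarrow> real" where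
  "residual_var e = kxx - gain e \<bullet> kx"

lemma noisy_cov_mult: "noisy_cov e *v u = K *v u + (1 / n) *\<^sub>R noise_scale e (noise_scale e u)"
proof -
  have "exp (e $ i) * u $ i = exp (e $ i / 2) * (exp (e $ i / 2) * u $ i)" for i
    by (simp flip: mult.assoc exp_add)
  moreover have "(\<Sum>j\<in>UNIV. (if i = j then exp (e $ i) else 0) * u $ j) = exp (e $ i) * u $ i" for i
    by (subst sum.remove[of UNIV i]) (auto intro!: sum.neutral)
  ultimately have "(\<chi> i j. if i = j then exp (e $ i) else 0) *v u = noise_scale e (noise_scale e u)"
    by (simp add: matrix_vector_mult_def noise_scale_def vec_eq_iff)
  then show ?thesis
    by (simp only: noisy_cov_def matrix_vector_mult_add_rdistrib scaleR_matrix_vector_assoc[symmetric])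
qed

lemma noisy_cov_quadratic:
  "u \<bullet> (noisy_cov e *v u) = u \<bullet> (K *v u) + (noise_scale e u \<bullet> noise_scale e u) / n"
  by (simp add: noisy_cov_mult inner_add_right inner_noise_scale)

lemma noisy_cov_coercive: "u \<bullet> (noisy_cov e *v u) \<ge> \<kappa> * (norm u)\<^sup>2"
  using K_coercive[of u] n by (simp add: noisy_cov_quadratic add_increasing2)

lemmas noisy_cov_inverse = coercive_matrix_inv[OF \<kappa> noisy_cov_coercive]

lemma noisy_cov_sym: "transpose (noisy_cov e) = noisy_cov e"
  using K_sym by (auto simp: noisy_cov_def transpose_def vec_eq_iff)

lemma noisy_cov_inv_sym: "transpose (matrix_inv (noisy_cov e)) = matrix_inv (noisy_cov e)"
  by (rule symmetric_matrix_inv[OF noisy_cov_sym noisy_cov_inverse(1,2)])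

lemma noisy_cov_self_adjoint: "u \<bullet> (noisy_cov e *v w) = (noisy_cov e *v u) \<bullet> w"
  by (metis dot_lmul_matrix noisy_cov_sym vector_transpose_matrix)

lemma noisy_cov_inv_self_adjoint:
  "u \<bullet> (matrix_inv (noisy_cov e) *v w) = (matrix_inv (noisy_cov e) *v u) \<bullet> w"
  by (metis dot_lmul_matrix noisy_cov_inv_sym vector_transpose_matrix)

lemma noisy_cov_gain: "noisy_cov e *v gain e = kx"
  by (simp add: gain_def matrix_vector_mul_assoc noisy_cov_inverse)

text \<open>
The normal equations \<open>noisy_cov_gain\<close> make the mixed term of the quadratic form in the
characteristic function vanish, so that frozen residual and data factorise.
\<close>

lemma fixed_level_uncorrelated:
  fixes e t :: "real ^ 'd"
  defines "Y' \<equiv> \<lambda>\<omega>. F \<omega> + noise_scale e (U \<omega>)"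
  defines "R' \<equiv> \<lambda>\<omega>. f0 \<omega> - gain e \<bullet> Y' \<omega>"
  shows "(\<integral>\<omega>. complex_of_real (R' \<omega>) * iexp (t \<bullet> Y' \<omega>) \<partial>M) = 0"
    and "(\<integral>\<omega>. complex_of_real ((R' \<omega>)\<^sup>2 - residual_var e) * iexp (t \<bullet> Y' \<omega>) \<partial>M) = 0"
proof -
  have "noise_scale e \<in> borel_measurable borel"
    unfolding noise_scale_def by (intro borel_measurable_continuous_onI continuous_intros)
  from measurable_compose[OF U this] have Y'[measurable]: "Y' \<in> borel_measurable M"
    unfolding Y'_def by measurable
  have R'[measurable]: "R' \<in> borel_measurable M" unfolding R'_def by measurable
  have joint: "(\<integral>\<omega>. iexp (s * R' \<omega> + r \<bullet> Y' \<omega>) \<partial>M)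
      = complex_of_real (exp (- (s\<^sup>2 * residual_var e) / 2) * exp (- (r \<bullet> (noisy_cov e *v r)) / 2))" for s r
  proof -
    \<comment> \<open>Substituting the residual, \<open>s R + r \<bullet> Y = s f0 + p \<bullet> Y\<close>.\<close>
    define p where "p = r - s *\<^sub>R gain e"
    have "s * R' \<omega> + r \<bullet> Y' \<omega> = s * f0 \<omega> + p \<bullet> F \<omega> + noise_scale e p \<bullet> U \<omega>" for \<omega>
      by (simp add: R'_def Y'_def p_def inner_add_right inner_diff_left inner_noise_scale
          linear_noise_scale algebra_simps)
    moreover have "s\<^sup>2 * kxx + 2 * s * (p \<bullet> kx) + p \<bullet> (K *v p) + (noise_scale e p \<bullet> noise_scale e p) / n
        = s\<^sup>2 * residual_var e + r \<bullet> (noisy_cov e *v r)"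
    proof -
      have "p \<bullet> (noisy_cov e *v p) = r \<bullet> (noisy_cov e *v r) - s * (r \<bullet> kx)
          - s * (gain e \<bullet> (noisy_cov e *v r)) + s\<^sup>2 * (gain e \<bullet> kx)"
        by (simp add: p_def matrix_vector_mult_diff_distrib matrix_vector_mult_scaleR noisy_cov_gain
            inner_diff_left inner_diff_right power2_eq_square algebra_simps)
      moreover have "gain e \<bullet> (noisy_cov e *v r) = r \<bullet> kx"
        by (simp add: noisy_cov_self_adjoint noisy_cov_gain inner_commute)
      moreover have "p \<bullet> (K *v p) + (noise_scale e p \<bullet> noise_scale e p) / n = p \<bullet> (noisy_cov e *v p)"
        by (rule noisy_cov_quadratic[symmetric])
      moreover have "p \<bullet> kx = r \<bullet> kx - s * (gain e \<bullet> kx)"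
        by (simp add: p_def inner_diff_left)
      ultimately show ?thesis
        by (simp only: residual_var_def add.assoc) (simp add: power2_eq_square algebra_simps)
    qed
    ultimately show ?thesis
      by (simp only: char_signal_noise) (simp add: add_divide_distrib flip: exp_add)
  qed
  have char_R: "(\<integral>\<omega>. iexp (s * R' \<omega>) \<partial>M) = exp (- (s\<^sup>2 * residual_var e) / 2)" for s
    using joint[of s 0] by simp
  note res = uncorrelated_gaussian_factor[OF R' _ char_R joint[of _ t]]
  show "(\<integral>\<omega>. complex_of_real (R' \<omega>) * iexp (t \<bullet> Y' \<omega>) \<partial>M) = 0"
    by (rule res(1)) measurable
  show "(\<integral>\<omega>. complex_of_real ((R' \<omega>)\<^sup>2 - residual_var e) * iexp (t \<bullet> Y' \<omega>) \<partial>M) = 0"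
    by (rule res(2)) measurable
qed

lemma inner_gain: "gain e \<bullet> y = kx \<bullet> (matrix_inv (noisy_cov e) *v y)"
  by (simp add: gain_def noisy_cov_inv_self_adjoint)

text \<open>
Uniform in the noise level, since \<open>\<kappa>\<close> is a bound for the noise-free covariance.
\<close>

lemma abs_inner_gain_le: "\<bar>gain e \<bullet> y\<bar> \<le> norm kx * norm y / \<kappa>"
proof -
  have "\<bar>gain e \<bullet> y\<bar> \<le> norm kx * norm (matrix_inv (noisy_cov e) *v y)"
    unfolding inner_gain by (rule Cauchy_Schwarz_ineq2)
  also have "\<dots> \<le> norm kx * (norm y / \<kappa>)"
    by (intro mult_left_mono noisy_cov_inverse(4)) simp
  finally show ?thesis by simp
qed

lemma noisy_cov_inv_entry_le: "\<bar>matrix_inv (noisy_cov e) $ i $ j\<bar> \<le> 1 / \<kappa>"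
proof -
  have "\<bar>matrix_inv (noisy_cov e) $ i $ j\<bar> = \<bar>(matrix_inv (noisy_cov e) *v axis j 1) $ i\<bar>"
    by (simp add: matrix_vector_mult_basis column_def)
  also have "\<dots> \<le> norm (matrix_inv (noisy_cov e) *v axis j 1)" by (rule component_le_norm_cart)
  also have "\<dots> \<le> 1 / \<kappa>" using noisy_cov_inverse(4)[of e "axis j 1"] by simp
  finally show ?thesis .
qed

lemma measurable_noisy_cov_inv_entry[measurable]:
  "(\<lambda>e. matrix_inv (noisy_cov e) $ i $ j) \<in> borel_measurable borel"
proof (rule borel_measurable_matrix_inv_entry)
  show "(\<lambda>e. noisy_cov e $ i $ j) \<in> borel_measurable borel" for i j
    unfolding noisy_cov_def
    by (cases "i = j") (auto intro!: borel_measurable_continuous_onI continuous_intros)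
qed (rule noisy_cov_inverse(3))

lemma measurable_gain[measurable]: "gain \<in> borel_measurable borel"
  by (rule borel_measurable_vecI) (simp add: gain_def matrix_vector_mult_def)

lemma measurable_residual_var[measurable]: "residual_var \<in> borel_measurable borel"
  unfolding residual_var_def by measurable

lemma measurable_Y[measurable]: "Y \<in> borel_measurable M"
proof -
  have "(\<lambda>\<omega>. F \<omega> + noise_scale (\<eta> \<omega>) (U \<omega>)) \<in> borel_measurable M" by measurable
  then show ?thesis by (subst measurable_cong[OF Y_eq]) auto
qed

lemma abs_residual_var_le: "\<bar>residual_var e\<bar> \<le> \<bar>kxx\<bar> + norm kx * norm kx / \<kappa>"
  using abs_inner_gain_le[of e kx] by (simp add: residual_var_def)

subsection \<open>Integrability\<close>

lemma signal_noise_square_integrable: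
  "integrable M (\<lambda>\<omega>. (\<alpha> * f0 \<omega> + b \<bullet> F \<omega> + c \<bullet> U \<omega>)\<^sup>2)"
proof -
  let ?L = "\<lambda>\<omega>. \<alpha> * f0 \<omega> + b \<bullet> F \<omega> + c \<bullet> U \<omega>"
  let ?q = "\<alpha>\<^sup>2 * kxx + 2 * \<alpha> * (b \<bullet> kx) + b \<bullet> (K *v b) + (c \<bullet> c) / n"
  have L[measurable]: "?L \<in> borel_measurable M" by measurable
  have char: "(\<integral>\<omega>. iexp (s * ?L \<omega>) \<partial>M) = exp (- (s\<^sup>2 * ?q) / 2)" for s
  proof -
    have "s * ?L \<omega> = (s * \<alpha>) * f0 \<omega> + (s *\<^sub>R b) \<bullet> F \<omega> + (s *\<^sub>R c) \<bullet> U \<omega>" for \<omega>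
      by (simp add: algebra_simps)
    moreover have "(s * \<alpha>)\<^sup>2 * kxx + 2 * (s * \<alpha>) * ((s *\<^sub>R b) \<bullet> kx) + (s *\<^sub>R b) \<bullet> (K *v (s *\<^sub>R b))
        + ((s *\<^sub>R c) \<bullet> (s *\<^sub>R c)) / n = s\<^sup>2 * ?q"
      by (simp add: matrix_vector_mult_scaleR power2_eq_square algebra_simps)
    ultimately show ?thesis by (simp only: char_signal_noise)
  qed
  note law = normal_law_of_char[OF L char]
  show ?thesis by (rule normal_law_moments(3)[OF L law])
qed

text \<open>
Independence of levels and noise makes the expectation of the product finite.
\<close>

lemma noise_square_integrable: "integrable M (\<lambda>\<omega>. exp (\<eta> \<omega> $ i) * (U \<omega> $ i)\<^sup>2)"
proof -
  let ?V = "\<lambda>\<omega>. (f0 \<omega>, F \<omega>, U \<omega>)"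
  let ?B = "borel \<Otimes>\<^sub>M borel \<Otimes>\<^sub>M borel :: (real \<times> (real ^ 'd) \<times> (real ^ 'd)) measure"
  interpret X: prob_space "distr M borel \<eta>" by (rule prob_space_distr) simp
  interpret Y: prob_space "distr M ?B ?V" by (rule prob_space_distr) simp
  interpret pair_sigma_finite "distr M borel \<eta>" "distr M ?B ?V" ..
  have U2: "integrable M (\<lambda>\<omega>. (U \<omega> $ i)\<^sup>2)"
    using signal_noise_square_integrable[of 0 0 "axis i 1"] by (simp add: inner_axis')
  have [measurable]: "(\<lambda>x::real ^ 'd. x $ i) \<in> borel_measurable borel"
    by (intro borel_measurable_continuous_onI continuous_intros)
  have "integrable (distr M borel \<eta> \<Otimes>\<^sub>M distr M ?B ?V) (\<lambda>(e, a, p, u). exp (e $ i) * (u $ i)\<^sup>2)"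
  proof (rule Fubini_integrable)
    have "(\<lambda>e. \<integral>v. norm (case (e, v) of (e, a, p, u) \<Rightarrow> exp (e $ i) * (u $ i)\<^sup>2) \<partial>distr M ?B ?V)
        = (\<lambda>e. exp (e $ i) * (\<integral>\<omega>. (U \<omega> $ i)\<^sup>2 \<partial>M))"
      by (rule ext) (subst integral_distr, auto simp: split_beta abs_mult)
    then show "integrable (distr M borel \<eta>)
        (\<lambda>e. \<integral>v. norm (case (e, v) of (e, a, p, u) \<Rightarrow> exp (e $ i) * (u $ i)\<^sup>2) \<partial>distr M ?B ?V)"
      using exp_\<eta>[of i] by (simp add: integrable_distr_eq)
    show "AE e in distr M borel \<eta>. integrable (distr M ?B ?V)
        (\<lambda>v. case (e, v) of (e, a, p, u) \<Rightarrow> exp (e $ i) * (u $ i)\<^sup>2)"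
      using U2 by (intro AE_I2) (subst integrable_distr_eq, auto simp: split_beta)
  qed measurable
  then show ?thesis
    unfolding indep by (subst (asm) integrable_distr_eq) auto
qed

lemma norm_Y_square_integrable: "integrable M (\<lambda>\<omega>. (norm (Y \<omega>))\<^sup>2)"
proof -
  have "integrable M (\<lambda>\<omega>. (Y \<omega> $ i)\<^sup>2)" for i
  proof (rule Bochner_Integration.integrable_bound)
    have "integrable M (\<lambda>\<omega>. (F \<omega> $ i)\<^sup>2)"
      using signal_noise_square_integrable[of 0 "axis i 1" 0] by (simp add: inner_axis')
    then show "integrable M (\<lambda>\<omega>. 2 * (F \<omega> $ i)\<^sup>2 + 2 * (exp (\<eta> \<omega> $ i) * (U \<omega> $ i)\<^sup>2))"
      using noise_square_integrable[of i] by simp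
    show "AE \<omega> in M. norm ((Y \<omega> $ i)\<^sup>2) \<le> norm (2 * (F \<omega> $ i)\<^sup>2 + 2 * (exp (\<eta> \<omega> $ i) * (U \<omega> $ i)\<^sup>2))"
    proof (rule AE_I2)
      fix \<omega> assume \<omega>: "\<omega> \<in> space M"
      define q where "q = exp (\<eta> \<omega> $ i / 2) * U \<omega> $ i"
      have q: "exp (\<eta> \<omega> $ i) * (U \<omega> $ i)\<^sup>2 = q\<^sup>2"
        by (simp add: q_def power_mult_distrib flip: exp_double)
      have "(F \<omega> $ i + q)\<^sup>2 \<le> 2 * (F \<omega> $ i)\<^sup>2 + 2 * q\<^sup>2"
        using sum_squares_bound[of "F \<omega> $ i" q] by (simp add: power2_sum)
      then show "norm ((Y \<omega> $ i)\<^sup>2) \<le> norm (2 * (F \<omega> $ i)\<^sup>2 + 2 * (exp (\<eta> \<omega> $ i) * (U \<omega> $ i)\<^sup>2))"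
        by (simp add: q Y_eq[OF \<omega>] noise_scale_def flip: q_def)
    qed
  qed (use measurable_vec_nth[OF measurable_Y] in measurable)
  then show ?thesis
    by (simp add: power2_norm_eq_inner inner_vec_def flip: power2_eq_square)
qed

subsection \<open>Fitted value and residual\<close>

definition fitted :: "'w \<Rightarrow> real" where
  "fitted \<omega> = gain (\<eta> \<omega>) \<bullet> Y \<omega>"

definition resid :: "'w \<Rightarrow> real" where
  "resid \<omega> = f0 \<omega> - fitted \<omega>"

lemma measurable_fitted[measurable]: "fitted \<in> borel_measurable M"
  unfolding fitted_def by measurable

lemma measurable_resid[measurable]: "resid \<in> borel_measurable M"
  unfolding resid_def by measurable

lemma f0_square_integrable: "integrable M (\<lambda>\<omega>. (f0 \<omega>)\<^sup>2)"
  using signal_noise_square_integrable[of 1 0 0] by simp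

lemma fitted_square_integrable: "integrable M (\<lambda>\<omega>. (fitted \<omega>)\<^sup>2)"
proof (rule Bochner_Integration.integrable_bound)
  show "integrable M (\<lambda>\<omega>. (norm kx / \<kappa>)\<^sup>2 * (norm (Y \<omega>))\<^sup>2)"
    using norm_Y_square_integrable by simp
  have "(fitted \<omega>)\<^sup>2 \<le> (norm kx / \<kappa>)\<^sup>2 * (norm (Y \<omega>))\<^sup>2" for \<omega>
    using power_mono[OF abs_inner_gain_le[of "\<eta> \<omega>" "Y \<omega>"], of 2]
    by (simp add: fitted_def power_divide power_mult_distrib)
  then show "AE \<omega> in M. norm ((fitted \<omega>)\<^sup>2) \<le> norm ((norm kx / \<kappa>)\<^sup>2 * (norm (Y \<omega>))\<^sup>2)"
    by simp
qed measurable

lemma resid_square_integrable: "integrable M (\<lambda>\<omega>. (resid \<omega>)\<^sup>2)"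
proof -
  have "integrable M (\<lambda>\<omega>. f0 \<omega> * fitted \<omega>)"
    by (intro integrable_product_of_squares f0_square_integrable fitted_square_integrable) measurable
  moreover have "(resid \<omega>)\<^sup>2 = (f0 \<omega>)\<^sup>2 - 2 * (f0 \<omega> * fitted \<omega>) + (fitted \<omega>)\<^sup>2" for \<omega>
    by (simp add: resid_def power2_eq_square algebra_simps)
  ultimately show ?thesis
    using f0_square_integrable fitted_square_integrable by simp
qed

lemma residual_var_integrable: "integrable M (\<lambda>\<omega>. residual_var (\<eta> \<omega>))"
  using abs_residual_var_le by (intro integrable_const_bound[of _ "\<bar>kxx\<bar> + norm kx * norm kx / \<kappa>"]) auto

lemma resid_integrable: "integrable M resid"
  using resid_square_integrable by (rule square_integrable_imp_integrable[rotated]) simp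

text \<open>
The residual is tested against functions of the data and the levels jointly, although only the data
are observed: the levels must be allowed because the fitted value depends on them, and the
character in \<open>\<eta>\<close> is constant once the levels are frozen.
\<close>

lemma orthogonal_to_data_and_levels:
  fixes \<psi> :: "real \<times> (real ^ 'd) \<Rightarrow> real" and \<phi> :: "(real ^ 'd) \<times> (real ^ 'd) \<Rightarrow> real"
  assumes \<psi>[measurable]: "\<psi> \<in> borel_measurable (borel \<Otimes>\<^sub>M borel)"
    and \<psi>_int: "integrable M (\<lambda>\<omega>. \<psi> (resid \<omega>, \<eta> \<omega>))"
    and fixed: "\<And>e t. (\<integral>\<omega>. complex_of_real (\<psi> (f0 \<omega> - gain e \<bullet> (F \<omega> + noise_scale e (U \<omega>)), e))
        * iexp (t \<bullet> (F \<omega> + noise_scale e (U \<omega>))) \<partial>M) = 0"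
    and \<phi>: "\<phi> \<in> borel_measurable borel"
    and int: "integrable M (\<lambda>\<omega>. \<phi> (Y \<omega>, \<eta> \<omega>) * \<psi> (resid \<omega>, \<eta> \<omega>))"
  shows "(\<integral>\<omega>. \<phi> (Y \<omega>, \<eta> \<omega>) * \<psi> (resid \<omega>, \<eta> \<omega>) \<partial>M) = 0"
proof (rule zero_fourier_transform_real[where Y = "\<lambda>\<omega>. (Y \<omega>, \<eta> \<omega>)" and \<phi> = \<phi>])
  show YE[measurable]: "(\<lambda>\<omega>. (Y \<omega>, \<eta> \<omega>)) \<in> borel_measurable M" by (intro borel_measurable_Pair) auto
  fix t :: "(real ^ 'd) \<times> (real ^ 'd)"
  define G where "G = (\<lambda>(e :: real ^ 'd) (a, p :: real ^ 'd, u).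
    complex_of_real (\<psi> (a - gain e \<bullet> (p + noise_scale e u), e))
      * iexp (fst t \<bullet> (p + noise_scale e u)) * iexp (snd t \<bullet> e))"
  let ?V = "\<lambda>\<omega>. (f0 \<omega>, F \<omega>, U \<omega>)"
  have G_eq: "complex_of_real (\<psi> (resid \<omega>, \<eta> \<omega>)) * iexp (t \<bullet> (Y \<omega>, \<eta> \<omega>)) = G (\<eta> \<omega>) (?V \<omega>)"
    if "\<omega> \<in> space M" for \<omega>
    by (simp add: G_def inner_prod_def Y_eq[OF that] resid_def fitted_def exp_add ring_distribs)
  have "integrable M (\<lambda>\<omega>. complex_of_real (\<psi> (resid \<omega>, \<eta> \<omega>)) * iexp (t \<bullet> (Y \<omega>, \<eta> \<omega>)))"
    using \<psi>_int by (intro integrable_mult_iexp) auto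
  then have G_int: "integrable M (\<lambda>\<omega>. G (\<eta> \<omega>) (?V \<omega>))"
    by (simp add: G_eq cong: Bochner_Integration.integrable_cong)
  have "(\<integral>\<omega>. complex_of_real (\<psi> (resid \<omega>, \<eta> \<omega>)) * iexp (t \<bullet> (Y \<omega>, \<eta> \<omega>)) \<partial>M)
      = (\<integral>\<omega>. G (\<eta> \<omega>) (?V \<omega>) \<partial>M)"
    by (intro Bochner_Integration.integral_cong refl G_eq)
  also have "\<dots> = (\<integral>\<omega>. (\<integral>\<omega>'. G (\<eta> \<omega>) (?V \<omega>') \<partial>M) \<partial>M)"
  proof (rule integral_indep_iterated[where G = G and X = \<eta> and Y = ?V, OF _ _ indep _ G_int])
    show "case_prod G \<in> borel_measurable (borel \<Otimes>\<^sub>M borel \<Otimes>\<^sub>M borel \<Otimes>\<^sub>M borel)"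
      unfolding G_def by measurable
  qed measurable
  also have "\<dots> = 0"
    unfolding G_def using fixed by simp
  finally show "(\<integral>\<omega>. complex_of_real (\<psi> (resid \<omega>, \<eta> \<omega>)) * iexp (t \<bullet> (Y \<omega>, \<eta> \<omega>)) \<partial>M) = 0" .
qed (use \<phi> \<psi>_int int in auto)

abbreviation \<D> :: "'w measure" where
  "\<D> \<equiv> vimage_algebra (space M) Y borel"

lemma cond_exp_orthogonal_eq_0:
  fixes \<psi> :: "real \<times> (real ^ 'd) \<Rightarrow> real" and \<phi> :: "(real ^ 'd) \<times> (real ^ 'd) \<Rightarrow> real"
  assumes \<psi>: "\<psi> \<in> borel_measurable (borel \<Otimes>\<^sub>M borel)"
    and \<psi>_int: "integrable M (\<lambda>\<omega>. \<psi> (resid \<omega>, \<eta> \<omega>))"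
    and fixed: "\<And>e t. (\<integral>\<omega>. complex_of_real (\<psi> (f0 \<omega> - gain e \<bullet> (F \<omega> + noise_scale e (U \<omega>)), e))
        * iexp (t \<bullet> (F \<omega> + noise_scale e (U \<omega>))) \<partial>M) = 0"
    and \<phi>[measurable]: "\<phi> \<in> borel_measurable borel"
    and int: "integrable M (\<lambda>\<omega>. \<phi> (Y \<omega>, \<eta> \<omega>) * \<psi> (resid \<omega>, \<eta> \<omega>))"
  shows "AE \<omega> in M. real_cond_exp M \<D> (\<lambda>\<omega>. \<phi> (Y \<omega>, \<eta> \<omega>) * \<psi> (resid \<omega>, \<eta> \<omega>)) \<omega> = 0"
proof (rule real_cond_exp_vimage_eq_0[OF int measurable_Y])
  fix B :: "(real ^ 'd) set" assume B[measurable]: "B \<in> sets borel"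
  have [measurable]: "(fst :: (real ^ 'd) \<times> (real ^ 'd) \<Rightarrow> _) \<in> borel_measurable borel"
    by (intro borel_measurable_continuous_onI continuous_intros)
  have eq: "\<phi> (Y \<omega>, \<eta> \<omega>) * \<psi> (resid \<omega>, \<eta> \<omega>) * indicator B (Y \<omega>)
      = (\<phi> (Y \<omega>, \<eta> \<omega>) * indicator B (fst (Y \<omega>, \<eta> \<omega>))) * \<psi> (resid \<omega>, \<eta> \<omega>)" for \<omega>
    by simp
  have "integrable M (\<lambda>\<omega>. \<phi> (Y \<omega>, \<eta> \<omega>) * \<psi> (resid \<omega>, \<eta> \<omega>) * indicator B (Y \<omega>))"
    by (rule Bochner_Integration.integrable_bound[OF int])
       (use int in \<open>auto simp: indicator_def\<close>)
  then show "(\<integral>\<omega>. \<phi> (Y \<omega>, \<eta> \<omega>) * \<psi> (resid \<omega>, \<eta> \<omega>) * indicator B (Y \<omega>) \<partial>M) = 0"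
    unfolding eq
    by (intro orthogonal_to_data_and_levels[OF \<psi> \<psi>_int fixed,
          where \<phi> = "\<lambda>z. \<phi> z * indicator B (fst z)"]) auto
qed

text \<open>
The tests are \<open>\<phi> = 1\<close>, and the fitted value for the mixed term of \<open>f0\<^sup>2\<close>.
\<close>

lemma cond_exp_resid_eq_0:
  shows "AE \<omega> in M. real_cond_exp M \<D> resid \<omega> = 0"
    and "AE \<omega> in M. real_cond_exp M \<D> (\<lambda>\<omega>. fitted \<omega> * resid \<omega>) \<omega> = 0"
    and "AE \<omega> in M. real_cond_exp M \<D> (\<lambda>\<omega>. (resid \<omega>)\<^sup>2 - residual_var (\<eta> \<omega>)) \<omega> = 0"
proof -
  have [measurable]: "(\<lambda>z::(real ^ 'd) \<times> (real ^ 'd). gain (snd z) \<bullet> fst z) \<in> borel_measurable borel"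
    unfolding borel_prod[symmetric] by measurable
  show "AE \<omega> in M. real_cond_exp M \<D> resid \<omega> = 0"
    using cond_exp_orthogonal_eq_0[of fst "\<lambda>_. 1"] resid_integrable fixed_level_uncorrelated(1)
    by simp
  have "integrable M (\<lambda>\<omega>. fitted \<omega> * resid \<omega>)"
    by (intro integrable_product_of_squares fitted_square_integrable resid_square_integrable) measurable
  then show "AE \<omega> in M. real_cond_exp M \<D> (\<lambda>\<omega>. fitted \<omega> * resid \<omega>) \<omega> = 0"
    using cond_exp_orthogonal_eq_0[of fst "\<lambda>z. gain (snd z) \<bullet> fst z"]
      resid_integrable fixed_level_uncorrelated(1)
    by (simp flip: fitted_def)
  show "AE \<omega> in M. real_cond_exp M \<D> (\<lambda>\<omega>. (resid \<omega>)\<^sup>2 - residual_var (\<eta> \<omega>)) \<omega> = 0"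
    using cond_exp_orthogonal_eq_0[of "\<lambda>(r, e). r\<^sup>2 - residual_var e" "\<lambda>_. 1"]
      resid_square_integrable residual_var_integrable fixed_level_uncorrelated(2)
    by simp
qed

subsection \<open>Posterior mean and variance\<close>

abbreviation Kinv :: "'w \<Rightarrow> real ^ 'd ^ 'd" where
  "Kinv \<omega> \<equiv> matrix_inv (noisy_cov (\<eta> \<omega>))"

lemma subalgebra_\<D>: "subalgebra M \<D>"
  by (rule subalgebra_vimage_algebra) measurable

lemma measurable_Y_\<D>: "Y \<in> borel_measurable \<D>"
  by (rule measurable_vimage_algebra1) auto

lemma Kinv_entry_integrable: "integrable M (\<lambda>\<omega>. Kinv \<omega> $ i $ j)"
  using noisy_cov_inv_entry_le by (intro integrable_const_bound[of _ "1 / \<kappa>"]) auto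

lemma posterior_mean:
  "AE \<omega> in M. real_cond_exp M \<D> f0 \<omega> = kx \<bullet> (cond_exp_matrix M \<D> Kinv \<omega> *v Y \<omega>)"
proof -
  interpret \<D>: finite_measure_subalgebra M \<D>
    by (intro finite_measure_subalgebra.intro finite_measure_axioms
        finite_measure_subalgebra_axioms.intro subalgebra_\<D>)
  have fitted: "integrable M fitted"
    using fitted_square_integrable by (rule square_integrable_imp_integrable[rotated]) simp
  have fitted_eq: "fitted = (\<lambda>\<omega>. kx \<bullet> (Kinv \<omega> *v Y \<omega>))"
    by (simp add: fun_eq_iff fitted_def inner_gain)
  have f0_eq: "f0 = (\<lambda>\<omega>. fitted \<omega> + resid \<omega>)" by (simp add: resid_def)
  have int: "integrable M (\<lambda>\<omega>. Y \<omega> $ j * Kinv \<omega> $ i $ j)" for i j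
  proof (rule integrable_product_of_squares)
    have "(Y \<omega> $ j)\<^sup>2 \<le> (norm (Y \<omega>))\<^sup>2" for \<omega>
      using power_mono[OF component_le_norm_cart abs_ge_zero, of "Y \<omega>" j 2] by simp
    then show "integrable M (\<lambda>\<omega>. (Y \<omega> $ j)\<^sup>2)"
      by (intro Bochner_Integration.integrable_bound[OF norm_Y_square_integrable]) auto
    show "integrable M (\<lambda>\<omega>. (Kinv \<omega> $ i $ j)\<^sup>2)"
      using power_mono[OF noisy_cov_inv_entry_le, of _ i j 2]
      by (intro integrable_const_bound[of _ "(1 / \<kappa>)\<^sup>2"]) auto
  qed measurable
  have "AE \<omega> in M. real_cond_exp M \<D> fitted \<omega> = kx \<bullet> (cond_exp_matrix M \<D> Kinv \<omega> *v Y \<omega>)"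
    unfolding fitted_eq
    by (rule cond_exp_matrix_bilinear[OF subalgebra_\<D> _ measurable_Y_\<D> int]) measurable
  moreover have "AE \<omega> in M. real_cond_exp M \<D> f0 \<omega> = real_cond_exp M \<D> fitted \<omega> + real_cond_exp M \<D> resid \<omega>"
    by (subst f0_eq) (rule \<D>.real_cond_exp_add[OF fitted resid_integrable])
  ultimately show ?thesis using cond_exp_resid_eq_0(1) by eventually_elim simp
qed

lemma sandwich_mult:
  "(Kinv \<omega> ** outer (Y \<omega>) (Y \<omega>) ** Kinv \<omega>) *v z = ((Kinv \<omega> *v Y \<omega>) \<bullet> z) *\<^sub>R (Kinv \<omega> *v Y \<omega>)"
  by (simp add: matrix_vector_mul_assoc[symmetric] outer_mult matrix_vector_mult_scaleR
      noisy_cov_inv_self_adjoint)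

lemma sandwich_entry_integrable:
  "integrable M (\<lambda>\<omega>. (Kinv \<omega> ** outer (Y \<omega>) (Y \<omega>) ** Kinv \<omega>) $ i $ j)"
proof (rule Bochner_Integration.integrable_bound)
  show "integrable M (\<lambda>\<omega>. (1 / \<kappa>)\<^sup>2 * (norm (Y \<omega>))\<^sup>2)" using norm_Y_square_integrable by simp
  show "(\<lambda>\<omega>. (Kinv \<omega> ** outer (Y \<omega>) (Y \<omega>) ** Kinv \<omega>) $ i $ j) \<in> borel_measurable M"
    by (simp add: matrix_matrix_mult_def outer_def)
  show "AE \<omega> in M. norm ((Kinv \<omega> ** outer (Y \<omega>) (Y \<omega>) ** Kinv \<omega>) $ i $ j)
      \<le> norm ((1 / \<kappa>)\<^sup>2 * (norm (Y \<omega>))\<^sup>2)"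
  proof (rule AE_I2)
    fix \<omega>
    let ?z = "Kinv \<omega> *v Y \<omega>"
    have "(Kinv \<omega> ** outer (Y \<omega>) (Y \<omega>) ** Kinv \<omega>) $ i $ j
        = ((Kinv \<omega> ** outer (Y \<omega>) (Y \<omega>) ** Kinv \<omega>) *v axis j 1) $ i"
      by (simp add: matrix_vector_mult_basis column_def)
    also have "\<dots> = ?z $ j * ?z $ i"
      unfolding sandwich_mult by (simp add: inner_axis)
    finally have "norm ((Kinv \<omega> ** outer (Y \<omega>) (Y \<omega>) ** Kinv \<omega>) $ i $ j) = \<bar>?z $ j\<bar> * \<bar>?z $ i\<bar>"
      by (simp add: abs_mult)
    also have "\<dots> \<le> (norm (Y \<omega>) / \<kappa>) * (norm (Y \<omega>) / \<kappa>)"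
      using order_trans[OF component_le_norm_cart noisy_cov_inverse(4)] \<kappa>
      by (intro mult_mono) auto
    finally show "norm ((Kinv \<omega> ** outer (Y \<omega>) (Y \<omega>) ** Kinv \<omega>) $ i $ j)
        \<le> norm ((1 / \<kappa>)\<^sup>2 * (norm (Y \<omega>))\<^sup>2)"
      by (simp add: power2_eq_square)
  qed
qed

text \<open>
With \<open>m\<close> the fitted value and \<open>R\<close> the residual,
\<open>f0\<^sup>2 = m\<^sup>2 + 2mR + (R\<^sup>2 - v) + v\<close>; the middle terms have conditional mean zero, \<open>m\<^sup>2\<close> is the
quadratic form of the sandwich matrix in \<open>kx\<close>, and \<open>v\<close> contributes \<open>kxx\<close> and the conditional mean
of the inverse.
\<close>

lemma posterior_variance:
  fixes EKinv :: "'w \<Rightarrow> real ^ 'd ^ 'd"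
  defines "EKinv \<equiv> cond_exp_matrix M \<D> Kinv"
  shows "AE \<omega> in M. cond_variance M \<D> f0 \<omega> = kxx + kx \<bullet>
    ((cond_exp_matrix M \<D> (\<lambda>\<omega>. Kinv \<omega> ** outer (Y \<omega>) (Y \<omega>) ** Kinv \<omega>) \<omega>
      - EKinv \<omega> ** outer (Y \<omega>) (Y \<omega>) ** EKinv \<omega> - EKinv \<omega>) *v kx)"
proof -
  interpret \<D>: finite_measure_subalgebra M \<D>
    by (intro finite_measure_subalgebra.intro finite_measure_axioms
        finite_measure_subalgebra_axioms.intro subalgebra_\<D>)
  let ?Q = "\<lambda>\<omega>. Kinv \<omega> ** outer (Y \<omega>) (Y \<omega>) ** Kinv \<omega>"
  let ?s = "\<lambda>\<omega>. kx \<bullet> (?Q \<omega> *v kx)" and ?t = "\<lambda>\<omega>. kx \<bullet> (Kinv \<omega> *v kx)"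
  let ?c = "\<lambda>\<omega>. fitted \<omega> * resid \<omega>" and ?d = "\<lambda>\<omega>. (resid \<omega>)\<^sup>2 - residual_var (\<eta> \<omega>)"
  have s_eq: "?s \<omega> = (fitted \<omega>)\<^sup>2" for \<omega>
    unfolding sandwich_mult
    by (simp add: fitted_def inner_gain power2_eq_square inner_commute[of _ kx])
  have t_eq: "?t \<omega> = kxx - residual_var (\<eta> \<omega>)" for \<omega>
    by (simp add: residual_var_def inner_gain)
  have int: "integrable M ?s" "integrable M ?t" "integrable M ?c" "integrable M ?d"
    using fitted_square_integrable resid_square_integrable residual_var_integrable
      integrable_product_of_squares[of fitted M resid]
    by (simp_all add: s_eq t_eq)
  have sq: "(\<lambda>\<omega>. (f0 \<omega>)\<^sup>2) = (\<lambda>\<omega>. (?s \<omega> - ?t \<omega>) + ((2 * ?c \<omega> + ?d \<omega>) + kxx))"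
    by (simp add: s_eq t_eq fun_eq_iff resid_def power2_eq_square algebra_simps)
  have sandwich_E: "kx \<bullet> ((EKinv \<omega> ** outer (Y \<omega>) (Y \<omega>) ** EKinv \<omega>) *v kx) = (kx \<bullet> (EKinv \<omega> *v Y \<omega>))\<^sup>2" for \<omega>
  proof -
    have "Kinv \<omega> $ i $ j = Kinv \<omega> $ j $ i" for \<omega> i j
      using arg_cong[OF noisy_cov_inv_sym[of "\<eta> \<omega>"], of "\<lambda>A. A $ j $ i"] by (simp add: transpose_def)
    then have "transpose (EKinv \<omega>) = EKinv \<omega>"
      by (simp add: EKinv_def cond_exp_matrix_def transpose_def vec_eq_iff)
    then have "Y \<omega> \<bullet> (EKinv \<omega> *v kx) = kx \<bullet> (EKinv \<omega> *v Y \<omega>)"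
      by (metis dot_lmul_matrix inner_commute vector_transpose_matrix)
    then show ?thesis
      by (simp add: matrix_vector_mul_assoc[symmetric] outer_mult matrix_vector_mult_scaleR power2_eq_square)
  qed
  have "AE \<omega> in M. real_cond_exp M \<D> (\<lambda>\<omega>. (f0 \<omega>)\<^sup>2) \<omega>
      = real_cond_exp M \<D> (\<lambda>\<omega>. ?s \<omega> - ?t \<omega>) \<omega> + real_cond_exp M \<D> (\<lambda>\<omega>. (2 * ?c \<omega> + ?d \<omega>) + kxx) \<omega>"
    unfolding sq using int by (intro \<D>.real_cond_exp_add) auto
  moreover have "AE \<omega> in M. real_cond_exp M \<D> (\<lambda>\<omega>. ?s \<omega> - ?t \<omega>) \<omega>
      = real_cond_exp M \<D> ?s \<omega> - real_cond_exp M \<D> ?t \<omega>"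
    using int by (intro \<D>.real_cond_exp_diff) auto
  moreover have "AE \<omega> in M. real_cond_exp M \<D> (\<lambda>\<omega>. (2 * ?c \<omega> + ?d \<omega>) + kxx) \<omega>
      = real_cond_exp M \<D> (\<lambda>\<omega>. 2 * ?c \<omega> + ?d \<omega>) \<omega> + real_cond_exp M \<D> (\<lambda>_. kxx) \<omega>"
    using int by (intro \<D>.real_cond_exp_add) auto
  moreover have "AE \<omega> in M. real_cond_exp M \<D> (\<lambda>\<omega>. 2 * ?c \<omega> + ?d \<omega>) \<omega>
      = real_cond_exp M \<D> (\<lambda>\<omega>. 2 * ?c \<omega>) \<omega> + real_cond_exp M \<D> ?d \<omega>"
    using int by (intro \<D>.real_cond_exp_add) auto
  moreover have "AE \<omega> in M. real_cond_exp M \<D> (\<lambda>\<omega>. 2 * ?c \<omega>) \<omega> = 2 * real_cond_exp M \<D> ?c \<omega>"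
    using int by (intro \<D>.real_cond_exp_cmult) auto
  moreover have "AE \<omega> in M. real_cond_exp M \<D> (\<lambda>_. kxx) \<omega> = kxx"
    by (intro \<D>.real_cond_exp_F_meas) auto
  moreover have "AE \<omega> in M. real_cond_exp M \<D> ?s \<omega> = kx \<bullet> (cond_exp_matrix M \<D> ?Q \<omega> *v kx)"
    using sandwich_entry_integrable
    by (intro cond_exp_matrix_bilinear[OF subalgebra_\<D>, where z = "\<lambda>_. kx"]) auto
  moreover have "AE \<omega> in M. real_cond_exp M \<D> ?t \<omega> = kx \<bullet> (EKinv \<omega> *v kx)"
    using Kinv_entry_integrable unfolding EKinv_def
    by (intro cond_exp_matrix_bilinear[OF subalgebra_\<D>, where z = "\<lambda>_. kx"]) auto
  moreover have "AE \<omega> in M. cond_variance M \<D> f0 \<omega>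
      = real_cond_exp M \<D> (\<lambda>\<omega>. (f0 \<omega>)\<^sup>2) \<omega> - (real_cond_exp M \<D> f0 \<omega>)\<^sup>2"
    by (rule cond_variance_eq[OF subalgebra_\<D> f0 f0_square_integrable])
  moreover note posterior_mean[folded EKinv_def] cond_exp_resid_eq_0(2,3)
  ultimately show ?thesis
    by eventually_elim (simp add: matrix_vector_mult_diff_rdistrib inner_diff_right sandwich_E)
qed

end

section \<open>The Gaussian process model\<close>

lemma sigma_algebra_generated_events: "sigma_algebra (space M) (generated_events M I Z)"
  unfolding generated_events_def by (rule sigma_algebra_sigma_sets) auto

text \<open>
Measurability is taken over \<open>sigma (space M) \<A>\<close> so that vectors built from the coordinates can be shown
to be \<open>\<A>\<close>-measurable by the usual closure rules.
\<close>

lemma measurable_generated_events: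
  assumes sub: "generated_events M I Z \<subseteq> \<A>" and \<A>: "sigma_algebra (space M) \<A>" and i: "i \<in> I"
  shows "Z i \<in> borel_measurable (sigma (space M) \<A>)"
proof (rule measurableI)
  interpret \<A>: sigma_algebra "space M" \<A> by fact
  fix B :: "real set" assume "B \<in> sets borel"
  then have "Z i -` B \<inter> space M \<in> generated_events M I Z"
    unfolding generated_events_def using i by (intro sigma_sets.Basic) blast
  then show "Z i -` B \<inter> space (sigma (space M) \<A>) \<in> sets (sigma (space M) \<A>)"
    using sub \<A>.space_closed by (auto simp: space_measure_of_conv)
qed simp

lemma (in prob_space) distr_pair_of_indep_measurable:
  assumes indep: "indep_set \<A> \<B>"
    and \<A>: "sigma_algebra (space M) \<A>" and \<B>: "sigma_algebra (space M) \<B>"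
    and X: "X \<in> measurable (sigma (space M) \<A>) S" and Y: "Y \<in> measurable (sigma (space M) \<B>) T"
  shows "distr M S X \<Otimes>\<^sub>M distr M T Y = distr M (S \<Otimes>\<^sub>M T) (\<lambda>\<omega>. (X \<omega>, Y \<omega>))"
proof (rule distr_pair_of_indep_set[OF indep])
  interpret \<A>: sigma_algebra "space M" \<A> by fact
  interpret \<B>: sigma_algebra "space M" \<B> by fact
  show "X -` C \<inter> space M \<in> \<A>" if "C \<in> sets S" for C
    using measurable_sets[OF X that] \<A>.space_closed by (simp add: space_measure_of_conv \<A>.sigma_sets_eq)
  show "Y -` C \<inter> space M \<in> \<B>" if "C \<in> sets T" for C
    using measurable_sets[OF Y that] \<B>.space_closed by (simp add: space_measure_of_conv \<B>.sigma_sets_eq)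
  show "X \<in> space M \<rightarrow> space S" "Y \<in> space M \<rightarrow> space T"
    using measurable_space[OF X] measurable_space[OF Y] by (auto simp: space_measure_of_conv)
qed

lemma (in prob_space) integral_iexp_add_of_indep:
  assumes X[measurable]: "X \<in> borel_measurable M" and Y[measurable]: "Y \<in> borel_measurable M"
    and distr: "distr M borel X \<Otimes>\<^sub>M distr M borel Y = distr M (borel \<Otimes>\<^sub>M borel) (\<lambda>\<omega>. (X \<omega>, Y \<omega>))"
  shows "(\<integral>\<omega>. iexp (X \<omega> + Y \<omega>) \<partial>M) = (\<integral>\<omega>. iexp (X \<omega>) \<partial>M) * (\<integral>\<omega>. iexp (Y \<omega>) \<partial>M)"
proof -
  have "indep_var borel X borel Y"
    using distr by (simp add: indep_var_distribution_eq)
  from char_distr_add[OF this, of 1] show ?thesis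
    by (simp add: char_def integral_distr)
qed

lemma sum_UNIV_option: "(\<Sum>i\<in>UNIV. G i) = G None + (\<Sum>d\<in>UNIV. G (Some d))"
  for G :: "'d::finite option \<Rightarrow> real"
  by (simp add: UNIV_option_conv sum.reindex)

text \<open>
The test point is adjoined to the training inputs as an extra index, which permits it to be one of
them.
\<close>

lemma (in prob_space) char_gp_marginal:
  fixes xs :: "'d::finite \<Rightarrow> 'x"
  assumes pd: "strictly_pd_kernel X k" and gp: "zero_mean_gp M X k f"
    and x: "x \<in> X" and xs: "range xs \<subseteq> X"
  shows "(\<integral>\<omega>. iexp (\<alpha> * f x \<omega> + b \<bullet> (\<chi> d. f (xs d) \<omega>)) \<partial>M)
    = exp (- (\<alpha>\<^sup>2 * k x x + 2 * \<alpha> * (b \<bullet> kernel_vec k xs x) + b \<bullet> (gram k xs *v b)) / 2)"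
proof -
  define p where "p = case_option x xs"
  define c where "c = case_option \<alpha> (\<lambda>d. b $ d)"
  have p: "range p \<subseteq> X"
  proof
    fix z assume "z \<in> range p"
    then obtain i where "z = p i" by auto
    then show "z \<in> X" using x xs by (cases i) (auto simp: p_def)
  qed
  let ?q = "\<Sum>i\<in>UNIV. \<Sum>j\<in>UNIV. c i * k (p i) (p j) * c j"
  have L_eq: "\<alpha> * f x \<omega> + b \<bullet> (\<chi> d. f (xs d) \<omega>) = (\<Sum>i\<in>UNIV. c i * f (p i) \<omega>)" for \<omega>
    by (simp add: sum_UNIV_option c_def p_def inner_vec_def)
  have "k (xs d) x = k x (xs d)" for d
    using strictly_pd_kernel_sym[OF pd] x xs by blast
  then have q_eq: "?q = \<alpha>\<^sup>2 * k x x + 2 * \<alpha> * (b \<bullet> kernel_vec k xs x) + b \<bullet> (gram k xs *v b)"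
    by (simp add: sum_UNIV_option c_def p_def inner_vec_def kernel_vec_def gram_def matrix_vector_mult_def
        sum.distrib sum_distrib_left power2_eq_square mult_ac)
  have q: "?q \<ge> 0"
    using strictly_pd_kernel_nonneg(1)[OF pd finite, of p] p by blast
  have [measurable]: "f (p i) \<in> borel_measurable M" for i
    using zero_mean_gp_measurable[OF gp] p by blast
  have "(\<integral>\<omega>. iexp (\<Sum>i\<in>UNIV. c i * f (p i) \<omega>) \<partial>M) = char (distr M borel (\<lambda>\<omega>. \<Sum>i\<in>UNIV. c i * f (p i) \<omega>)) 1"
    unfolding char_def by (subst integral_distr) auto
  also have "\<dots> = char (normal_law 0 ?q) 1"
    using zero_mean_gp_linear_combination[OF gp finite, of p UNIV c] p by simp
  also have "\<dots> = exp (- ?q / 2)"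
    by (simp only: char_normal_law_0[OF q]) simp
  finally show ?thesis unfolding L_eq q_eq .
qed

text \<open>
Each of the \<open>S\<close> noises enters with coefficient \<open>c\<^sub>d / S\<close>, so averaging divides the variance by \<open>S\<close>.
\<close>

lemma (in prob_space) char_noise_average:
  fixes u :: "'d::finite \<times> nat \<Rightarrow> 'a \<Rightarrow> real"
  assumes S: "S \<ge> 1" and indep: "indep_vars (\<lambda>_. borel) u (UNIV \<times> {1..S})"
    and normal: "\<And>i. i \<in> UNIV \<times> {1..S} \<Longrightarrow> distributed M lborel (u i) std_normal_density"
  shows "(\<integral>\<omega>. iexp (c \<bullet> (\<chi> d. (1 / real S) * (\<Sum>s=1..S. u (d, s) \<omega>))) \<partial>M) = exp (- ((c \<bullet> c) / real S) / 2)"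
proof -
  have "c \<bullet> (\<chi> d. (1 / real S) * (\<Sum>s=1..S. u (d, s) \<omega>))
      = (\<Sum>i\<in>UNIV \<times> {1..S}. (c $ fst i / real S) * u i \<omega>)" for \<omega>
    by (simp add: inner_vec_def sum.cartesian_product sum_distrib_left sum_divide_distrib split_beta)
  moreover have "(\<Sum>i\<in>UNIV \<times> {1..S}. (c $ fst i / real S)\<^sup>2) = (c \<bullet> c) / real S"
  proof -
    have "(\<Sum>i\<in>UNIV \<times> {1..S}. (c $ fst i / real S)\<^sup>2) = (\<Sum>d\<in>UNIV. \<Sum>s=1..S. (c $ d / real S)\<^sup>2)"
      by (simp add: sum.cartesian_product split_beta del: sum_constant)
    also have "\<dots> = (\<Sum>d\<in>UNIV. c $ d * c $ d / real S)"
      using S by (intro sum.cong refl) (simp add: power2_eq_square field_simps)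
    finally show ?thesis by (simp add: inner_vec_def sum_divide_distrib)
  qed
  ultimately show ?thesis
    using char_std_normal_combination[OF _ indep normal, of "\<lambda>i. c $ fst i / real S"] by simp
qed

lemma gram_quadratic: "u \<bullet> (gram k xs *v u) = (\<Sum>i\<in>UNIV. \<Sum>j\<in>UNIV. u $ i * k (xs i) (xs j) * u $ j)"
  by (simp add: inner_vec_def gram_def matrix_vector_mult_def sum_distrib_left mult_ac)

theorem theorem1:
  fixes M :: "'w measure"
    and X :: "(real ^ 'n) set"
    and f g h :: "real ^ 'n \<Rightarrow> 'w \<Rightarrow> real"
    and k l :: "real ^ 'n \<Rightarrow> real ^ 'n \<Rightarrow> real"
    and xs :: "'d::finite \<Rightarrow> real ^ 'n"
    and S :: nat
    and w y :: "'d \<Rightarrow> nat \<Rightarrow> 'w \<Rightarrow> real"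
    and x :: "real ^ 'n"
  assumes prob: "prob_space M"
    and g_pos: "\<And>z \<omega>. z \<in> X \<Longrightarrow> \<omega> \<in> space M \<Longrightarrow> g z \<omega> > 0"
    and h_eq: "\<And>z \<omega>. z \<in> X \<Longrightarrow> \<omega> \<in> space M \<Longrightarrow> h z \<omega> = ln ((g z \<omega>)\<^sup>2)"
    and inputs: "inj xs" "range xs \<subseteq> X"
    and S_pos: "S \<ge> 1"
    and y_eq: "\<And>d s \<omega>. s \<in> {1..S} \<Longrightarrow> \<omega> \<in> space M \<Longrightarrow> y d s \<omega> = f (xs d) \<omega> + w d s \<omega>"
    and noise_normal: "\<And>d s. s \<in> {1..S} \<Longrightarrow>
      distributed M lborel (\<lambda>\<omega>. w d s \<omega> / g (xs d) \<omega>) std_normal_density"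
    and noise_indep: "prob_space.indep_vars M (\<lambda>_. borel)
      (\<lambda>(d, s) \<omega>. w d s \<omega> / g (xs d) \<omega>) (UNIV \<times> {1..S})"
    and noise_indep_fh: "prob_space.indep_set M
      (generated_events M (UNIV \<times> {1..S}) (\<lambda>(d, s) \<omega>. w d s \<omega> / g (xs d) \<omega>))
      (sigma_sets (space M) (generated_events M X f \<union> generated_events M X h))"
    and fh_indep: "prob_space.indep_set M (generated_events M X f) (generated_events M X h)"
    and kernels: "strictly_pd_kernel X k" "strictly_pd_kernel X l"
    and f_gp: "zero_mean_gp M X k f"
    and h_gp: "zero_mean_gp M X l h"
    and x: "x \<in> X"
  shows "let yE = empirical_mean S y;
             \<D> = vimage_algebra (space M) yE borel;
             Kinv = (\<lambda>\<omega>. matrix_inv (noisy_gram k xs S (\<chi> d. h (xs d) \<omega>)));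
             EKinv = cond_exp_matrix M \<D> Kinv;
             \<K> = (\<lambda>\<omega>. cond_exp_matrix M \<D> (\<lambda>\<omega>'. Kinv \<omega>' ** outer (yE \<omega>') (yE \<omega>') ** Kinv \<omega>') \<omega>
                       - EKinv \<omega> ** outer (yE \<omega>) (yE \<omega>) ** EKinv \<omega>
                       - EKinv \<omega>);
             kx = kernel_vec k xs x
         in (AE \<omega> in M. real_cond_exp M \<D> (f x) \<omega> = kx \<bullet> (EKinv \<omega> *v yE \<omega>)) \<and>
            (AE \<omega> in M. cond_variance M \<D> (f x) \<omega> = k x x + kx \<bullet> (\<K> \<omega> *v kx))"
proof -
  interpret prob_space M by (rule prob)
  let ?u = "\<lambda>(d, s) \<omega>. w d s \<omega> / g (xs d) \<omega>"
  let ?I = "UNIV \<times> {1..S} :: ('d \<times> nat) set"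
  let ?F = "\<lambda>\<omega>. \<chi> d. f (xs d) \<omega>"
  let ?\<eta> = "\<lambda>\<omega>. \<chi> d. h (xs d) \<omega>"
  let ?U = "\<lambda>\<omega>. \<chi> d. (1 / real S) * (\<Sum>s=1..S. ?u (d, s) \<omega>)"
  let ?\<N> = "generated_events M ?I ?u"
  let ?\<F> = "generated_events M X f"
  let ?\<H> = "generated_events M X h"
  let ?\<F>\<H> = "sigma_sets (space M) (?\<F> \<union> ?\<H>)"
  let ?\<N>\<F> = "sigma_sets (space M) (?\<N> \<union> ?\<F>)"
  have xsX: "xs d \<in> X" for d using inputs(2) by auto
  have into: "?\<N> \<subseteq> Pow (space M)" "?\<F> \<subseteq> Pow (space M)" "?\<H> \<subseteq> Pow (space M)"
    by (auto simp: generated_events_def dest: sigma_sets_into_sp[rotated])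
  have sa: "sigma_algebra (space M) ?\<F>\<H>" "sigma_algebra (space M) ?\<N>\<F>"
    using into by (auto intro!: sigma_algebra_sigma_sets)
  note sa_gen = sigma_algebra_generated_events[of M]
  have h_fu: "indep_set ?\<H> ?\<N>\<F>"
    by (rule indep_set_regroup[OF sa_gen sa_gen sa_gen noise_indep_fh fh_indep])
  have f_F: "f z \<in> borel_measurable (sigma (space M) \<A>)"
    if "?\<F> \<subseteq> \<A>" "sigma_algebra (space M) \<A>" "z \<in> X" for \<A> z
    using that by (rule measurable_generated_events)
  have u_N: "(\<lambda>\<omega>. w d s \<omega> / g (xs d) \<omega>) \<in> borel_measurable (sigma (space M) \<A>)"
    if "?\<N> \<subseteq> \<A>" "sigma_algebra (space M) \<A>" "s \<in> {1..S}" for \<A> d s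
    using measurable_generated_events[OF that(1,2), of "(d, s)"] that(3) by simp
  have h_H: "h z \<in> borel_measurable (sigma (space M) ?\<H>)" if "z \<in> X" for z
    using order_refl sa_gen that by (rule measurable_generated_events)
  have U_N: "?U \<in> borel_measurable (sigma (space M) \<A>)"
    if "?\<N> \<subseteq> \<A>" "sigma_algebra (space M) \<A>" for \<A>
    by (rule borel_measurable_vecI) (auto intro!: borel_measurable_divide borel_measurable_sum u_N[OF that])
  have F_F: "?F \<in> borel_measurable (sigma (space M) \<A>)"
    if "?\<F> \<subseteq> \<A>" "sigma_algebra (space M) \<A>" for \<A>
    by (rule borel_measurable_vecI) (auto intro!: f_F[OF that] xsX)
  have f_M[measurable]: "f z \<in> borel_measurable M" if "z \<in> X" for z
    using f_gp that by (rule zero_mean_gp_measurable)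
  have h_M[measurable]: "h z \<in> borel_measurable M" if "z \<in> X" for z
    using h_gp that by (rule zero_mean_gp_measurable)
  have u_M: "(\<lambda>\<omega>. w d s \<omega> / g (xs d) \<omega>) \<in> borel_measurable M" if "s \<in> {1..S}" for d s
    using noise_normal[OF that, of d] by (simp add: distributed_def)
  have F_M[measurable]: "?F \<in> borel_measurable M"
    by (rule borel_measurable_vecI) (simp add: f_M xsX)
  have \<eta>_M: "?\<eta> \<in> borel_measurable M"
    by (rule borel_measurable_vecI) (simp add: h_M xsX)
  have U_M[measurable]: "?U \<in> borel_measurable M"
    by (rule borel_measurable_vecI) (auto intro!: borel_measurable_divide borel_measurable_sum u_M)
  have sub: "?\<N> \<subseteq> ?\<N>\<F>" "?\<F> \<subseteq> ?\<N>\<F>" "?\<F> \<subseteq> ?\<F>\<H>" by auto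

  have char: "(\<integral>\<omega>. iexp (\<alpha> * f x \<omega> + b \<bullet> ?F \<omega> + c \<bullet> ?U \<omega>) \<partial>M)
      = exp (- (\<alpha>\<^sup>2 * k x x + 2 * \<alpha> * (b \<bullet> kernel_vec k xs x) + b \<bullet> (gram k xs *v b)
        + (c \<bullet> c) / real S) / 2)" for \<alpha> b c
  proof -
    let ?L = "\<lambda>\<omega>. \<alpha> * f x \<omega> + b \<bullet> ?F \<omega>" and ?N = "\<lambda>\<omega>. c \<bullet> ?U \<omega>"
    have "?N \<in> borel_measurable (sigma (space M) ?\<N>)"
      by (intro borel_measurable_inner borel_measurable_const U_N[OF order_refl sa_gen])
    moreover have "?L \<in> borel_measurable (sigma (space M) ?\<F>\<H>)"
      by (intro borel_measurable_inner borel_measurable_const borel_measurable_add borel_measurable_times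
          F_F[OF sub(3) sa(1)] f_F[OF sub(3) sa(1) x])
    ultimately have "distr M borel ?N \<Otimes>\<^sub>M distr M borel ?L = distr M (borel \<Otimes>\<^sub>M borel) (\<lambda>\<omega>. (?N \<omega>, ?L \<omega>))"
      by (rule distr_pair_of_indep_measurable[OF noise_indep_fh sa_gen sa(1)])
    then have "(\<integral>\<omega>. iexp (?N \<omega> + ?L \<omega>) \<partial>M) = (\<integral>\<omega>. iexp (?N \<omega>) \<partial>M) * (\<integral>\<omega>. iexp (?L \<omega>) \<partial>M)"
      by (intro integral_iexp_add_of_indep borel_measurable_inner borel_measurable_const
          borel_measurable_add borel_measurable_times F_M U_M f_M x)
    also have "(\<integral>\<omega>. iexp (?N \<omega>) \<partial>M) = exp (- ((c \<bullet> c) / real S) / 2)"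
      by (rule char_noise_average[OF S_pos noise_indep]) (auto intro: noise_normal)
    also have "(\<integral>\<omega>. iexp (?L \<omega>) \<partial>M)
        = exp (- (\<alpha>\<^sup>2 * k x x + 2 * \<alpha> * (b \<bullet> kernel_vec k xs x) + b \<bullet> (gram k xs *v b)) / 2)"
      by (rule char_gp_marginal[OF kernels(1) f_gp x inputs(2)])
    finally show ?thesis
      by (simp only: add.commute[of "?L _"] of_real_mult[symmetric] exp_add[symmetric])
         (simp add: add_divide_distrib add.commute)
  qed

  have indep: "distr M borel ?\<eta> \<Otimes>\<^sub>M distr M (borel \<Otimes>\<^sub>M borel \<Otimes>\<^sub>M borel) (\<lambda>\<omega>. (f x \<omega>, ?F \<omega>, ?U \<omega>))
      = distr M (borel \<Otimes>\<^sub>M borel \<Otimes>\<^sub>M borel \<Otimes>\<^sub>M borel) (\<lambda>\<omega>. (?\<eta> \<omega>, f x \<omega>, ?F \<omega>, ?U \<omega>))"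
  proof (rule distr_pair_of_indep_measurable[OF h_fu sa_gen sa(2)])
    show "?\<eta> \<in> borel_measurable (sigma (space M) ?\<H>)"
      by (rule borel_measurable_vecI) (simp add: h_H xsX)
    show "(\<lambda>\<omega>. (f x \<omega>, ?F \<omega>, ?U \<omega>)) \<in> measurable (sigma (space M) ?\<N>\<F>) (borel \<Otimes>\<^sub>M borel \<Otimes>\<^sub>M borel)"
      by (intro measurable_Pair f_F[OF sub(2) sa(2) x] F_F[OF sub(2) sa(2)] U_N[OF sub(1) sa(2)])
  qed

  have exp_h: "integrable M (\<lambda>\<omega>. exp (?\<eta> \<omega> $ i))" for i
  proof -
    have "distr M borel (h (xs i)) = normal_law 0 (l (xs i) (xs i))"
      using zero_mean_gp_linear_combination[OF h_gp, of "{i}" xs "\<lambda>_. 1"] xsX by simp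
    moreover have "l (xs i) (xs i) \<ge> 0"
      using strictly_pd_kernel_nonneg(1)[OF kernels(2), of "{i}" xs "\<lambda>_. 1"] xsX by simp
    ultimately show ?thesis
      using normal_law_moments(5)[of "h (xs i)" "l (xs i) (xs i)"] h_M[OF xsX] by simp
  qed

  have Y_eq: "empirical_mean S y \<omega> = ?F \<omega> + noise_scale (?\<eta> \<omega>) (?U \<omega>)" if \<omega>: "\<omega> \<in> space M" for \<omega>
  proof (rule vec_eq_iff[THEN iffD2, rule_format])
    fix d
    have g: "g (xs d) \<omega> > 0" by (rule g_pos[OF xsX \<omega>])
    \<comment> \<open>The log variance is twice the log standard deviation, as \<open>g\<close> is positive.\<close>
    have "exp (h (xs d) \<omega> / 2) = g (xs d) \<omega>"
      using g by (simp add: h_eq[OF xsX \<omega>] ln_realpow)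
    moreover have "(\<Sum>s=1..S. y d s \<omega>) = real S * f (xs d) \<omega> + g (xs d) \<omega> * (\<Sum>s=1..S. w d s \<omega> / g (xs d) \<omega>)"
      using g by (simp add: y_eq[OF _ \<omega>] sum.distrib sum_distrib_left)
    ultimately show "empirical_mean S y \<omega> $ d = (?F \<omega> + noise_scale (?\<eta> \<omega>) (?U \<omega>)) $ d"
      using S_pos by (simp add: empirical_mean_def noise_scale_def field_simps)
  qed

  have "u \<bullet> (gram k xs *v u) > 0" if "u \<noteq> 0" for u
    unfolding gram_quadratic
    using that inputs by (intro strictly_pd_kernel_nonneg(2)[OF kernels(1)]) (auto simp: vec_eq_iff)
  then obtain \<kappa> where \<kappa>: "\<kappa> > 0" "\<And>u. u \<bullet> (gram k xs *v u) \<ge> \<kappa> * (norm u)\<^sup>2"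
    using positive_definite_coercive by blast
  have sym: "transpose (gram k xs) = gram k xs"
    using strictly_pd_kernel_sym[OF kernels(1) xsX xsX] by (simp add: gram_def transpose_def vec_eq_iff)

  interpret R: heteroscedastic_regression M "f x" ?F ?U ?\<eta> "empirical_mean S y" "gram k xs"
      "kernel_vec k xs x" "k x x" "real S" \<kappa>
    using f_M[OF x] F_M U_M \<eta>_M char indep exp_h Y_eq sym \<kappa> S_pos
    by unfold_locales auto
  have "R.noisy_cov e = noisy_gram k xs S e" for e
    by (simp add: R.noisy_cov_def noisy_gram_def)
  then show ?thesis
    unfolding Let_def using R.posterior_mean R.posterior_variance by simp
qed

end
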